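(* Let $\ell$ be a positive odd integer having at most two distinct prime factors. Then for every positive integer $n$, the product $\Omega_\ell(n)=(1^\ell+1)(2^\ell+1)\cdots(n^\ell+1)$ is not a powerful number.
   Context: A positive integer $a$ is called a powerful number if for every prime $p$, $p\mid a$ implies $p^2\mid a$. For a positive integer $\ell$ and positive integer $n$, $\Omega_\ell(n)=\prod_{a=1}^{n}(a^\ell+1)$. *)

theory Defs
  imports "HOL-Computational_Algebra.Primes"
begin

definition powerful :: "nat \<Rightarrow> bool" where
  "powerful a \<longleftrightarrow> a > 0 \<and> (\<forall>p. prime p \<longrightarrow> p dvd a \<longrightarrow> p^2 dvd a)"

definition Omega :: "nat \<Rightarrow> nat \<Rightarrow> nat" where
  "Omega l n = (\<Prod>a=1..n. a^l + 1)"

end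

theory Submission
  imports Defs "HOL-Number_Theory.Number_Theory" "HOL-Analysis.Harmonic_Numbers"
begin

text \<open>
  Put \<open>m = n + 1\<close>. If \<open>p\<close> is a prime with \<open>m / 2 < p \<le> m\<close> that does not divide \<open>l\<close>, and \<open>p - 1\<close> is coprime
  to \<open>l\<close>, then \<open>a ^ l + 1\<close> is divisible by \<open>p\<close> only for \<open>a = p - 1\<close> among \<open>a \<le> n\<close>, and there exactly
  once; so it suffices to find such a \<open>p\<close>.

  For \<open>m < 2 ^ 30\<close> it is enough to have, in each interval, three primes \<open>p\<close> such that no odd prime divides
  two of the numbers \<open>p (p - 1)\<close>, because \<open>l\<close> has at most two prime factors. For a few \<open>m \<le> 22\<close> no good
  prime exists and another prime divisor of the product, congruent to 1 modulo a factor of \<open>l\<close>, is used.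

  For large \<open>m\<close> only primes congruent to 5 modulo 6 are considered, which takes care of the factor 3 of
  \<open>l\<close>. A Chebyshev-type combination of \<open>ln (m!)\<close> and of \<open>\<Sum> \<chi> n ln n\<close>, \<open>\<chi>\<close> the character modulo 3,
  shows that they have total logarithmic weight at least \<open>0.19 m\<close> in \<open>(m / 2, m]\<close>. Those congruent to
  1 modulo \<open>q\<close> lie in a progression modulo \<open>6 q\<close>, and the product of \<open>N\<close> terms of it is divisible by
  the part of \<open>N!\<close> coprime to \<open>6 q\<close> and by all its primes; this bounds their weight. In the worst case,
  \<open>q = 5\<close> together with \<open>q = 7\<close>, the bounds add up to less than \<open>0.1876 m\<close>.
\<close>

section \<open>Primes dividing the product exactly once\<close>

text \<open>The progression bound is of sieve type and exceeds the true weight of a class by a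
  factor of about 2, so small primes \<open>q\<close> are charged too much. Applied to all primes,
  the charges for \<open>q = 3\<close> and \<open>q = 5\<close> would together exceed the whole
  weight in \<open>(m / 2, m]\<close>, which is about \<open>m / 2\<close>. Hence 3 is removed
  beforehand by fixing one class modulo 6, and a character is needed to isolate that class. Its true
  weight is about \<open>m / 4\<close>; 0.19 is what the elementary combination yields, against the
  charges 0.1076 for \<open>q = 5\<close>, 0.08 for \<open>q = 7\<close> and at most 0.054 for any
  later prime. A third prime factor would break this comparison. The gap of \<open>0.0024 m\<close>,
  and a much smaller one behind the constant 0.19, have to absorb error terms such as 120000 and
  \<open>sqrt m * ln m\<close>. This is why the analytic argument starts at \<open>2 ^ 30\<close>
  and explicit primes are needed up to there. As \<open>l\<close> is odd, the factor 2 of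
  \<open>p - 1\<close> never matters.\<close>

lemma power_plus_one_dvdD:
  fixes P a l g h :: nat
  assumes P: "prime P" "P = g * h + 1" and l: "odd l" "g dvd l" "coprime l h"
    and h: "even h \<or> P = 2" and dvd: "P dvd a ^ l + 1"
  shows "P dvd a ^ g + 1"
proof -
  obtain k where k: "l = g * k" using l by blast
  \<comment> \<open>With this \<open>x\<close>, the assumption says \<open>x ^ k = 1\<close> modulo
    \<open>P\<close> because \<open>k\<close> is odd, and Fermat says \<open>x ^ h = 1\<close>. As
    \<open>k\<close> and \<open>h\<close> are coprime, \<open>x = 1\<close>.\<close>
  define x where "x = - (int a ^ g)"
  have kodd: "odd k" "k > 0" using l k by (auto elim: oddE intro: Nat.gr0I)
  have cop: "coprime k h" using l k by simp
  have "int P dvd int a ^ l + 1"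
  proof -
    have "int P dvd int (a ^ l + 1)" using dvd by (simp only: of_nat_dvd_iff)
    thus ?thesis by (simp add: add.commute)
  qed
  moreover have "int a ^ l + 1 = 1 - x ^ k"
    using kodd by (simp add: k x_def power_mult power_minus_odd)
  ultimately have xk: "[x ^ k = 1] (mod int P)"
    by (simp add: cong_iff_dvd_diff dvd_diff_commute)
  have nda: "\<not> P dvd a"
  proof
    assume "P dvd a"
    hence "P dvd a ^ l" using l(1) by (metis dvd_power odd_pos dvd_trans)
    hence "P dvd 1" using dvd dvd_add_right_iff by blast
    thus False using P(1) not_prime_1 by (metis nat_dvd_1_iff_1)
  qed
  have "[a ^ (P - 1) = 1] (mod P)" using P nda by (intro fermat_theorem) auto
  hence "[int a ^ (g * h) = 1] (mod int P)"
    using P(2) by (simp flip: cong_int_iff)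
  \<comment> \<open>The sign of \<open>x\<close> disappears for even \<open>h\<close>; for
    \<open>P = 2\<close> it is irrelevant, since \<open>- z = z\<close> modulo 2.\<close>
  moreover have "[x ^ h = int a ^ (g * h)] (mod int P)"
  proof (cases "even h")
    case True
    thus ?thesis by (simp add: x_def power_mult)
  next
    case False
    hence "P = 2" using h by simp
    moreover have "[- z = z] (mod 2)" for z :: int by (simp add: cong_iff_dvd_diff)
    ultimately show ?thesis using False by (simp add: x_def power_mult power_minus_odd)
  qed
  ultimately have xh: "[x ^ h = 1] (mod int P)" by (rule cong_trans[rotated])
  obtain d u v where duv: "d dvd k" "d dvd h" "k * u = h * v + d"
    using bezout_add_strong_nat[of k h] \<open>k > 0\<close> by blast
  have "d = 1" using coprime_common_divisor_nat[OF cop duv(1,2)] .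
  hence "k * u = h * v + 1" using duv by simp
  hence "(x ^ k) ^ u = (x ^ h) ^ v * x"
    by (simp add: power_add flip: power_mult)
  moreover have "[(x ^ k) ^ u = 1] (mod int P)" using cong_pow[OF xk, of u] by simp
  moreover have "[(x ^ h) ^ v * x = 1 ^ v * x] (mod int P)"
    by (intro cong_mult cong_pow xh cong_refl)
  ultimately have "[x = 1] (mod int P)" 
    by (metis (no_types) cong_sym cong_trans mult_1 power_one)
  hence "int P dvd 1 - x" by (meson cong_iff_dvd_diff cong_sym)
  hence "int P dvd int (a ^ g + 1)" by (simp add: x_def)
  thus ?thesis by (simp only: of_nat_dvd_iff)
qed

text \<open>Lifting the exponent: with \<open>x = - y\<close>, which is 1 modulo \<open>P\<close>,
  the cofactor \<open>\<Sum>i<k. x ^ i\<close> is congruent to \<open>k\<close>, so it contributes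
  no factor \<open>P\<close>.\<close>

lemma square_dvd_power_plus_oneD:
  fixes P y k :: nat
  assumes P: "prime P" "P dvd y + 1" "\<not> P dvd k" "odd k" and dvd: "P\<^sup>2 dvd y ^ k + 1"
  shows "P\<^sup>2 dvd y + 1"
proof -
  define x where "x = - int y"
  have x1: "[x = 1] (mod int P)"
  proof -
    have "int P dvd int (y + 1)" using P(2) by (simp only: of_nat_dvd_iff)
    hence "int P dvd 1 - x" by (simp add: x_def add.commute)
    thus ?thesis by (meson cong_iff_dvd_diff cong_sym)
  qed
  have "int (y ^ k + 1) = 1 - x ^ k" using P by (simp add: x_def power_minus_odd)
  also have "\<dots> = (1 - x) * (\<Sum>i<k. x ^ i)" by (rule one_diff_power_eq)
  finally have eq: "int (y ^ k + 1) = (1 - x) * (\<Sum>i<k. x ^ i)" .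
  have "[(\<Sum>i<k. x ^ i) = (\<Sum>i<k. 1)] (mod int P)"
    using cong_pow[OF x1] by (intro cong_sum) simp
  hence "int P dvd (\<Sum>i<k. x ^ i) \<longleftrightarrow> int P dvd int k"
    by (simp add: cong_dvd_iff)
  hence "\<not> int P dvd (\<Sum>i<k. x ^ i)" using P(3) by simp
  hence "coprime (int P ^ 2) (\<Sum>i<k. x ^ i)"
    using P(1) by (simp add: prime_imp_coprime)
  moreover have "int P ^ 2 dvd (1 - x) * (\<Sum>i<k. x ^ i)"
  proof -
    have "int (P\<^sup>2) dvd int (y ^ k + 1)" using dvd by (simp only: of_nat_dvd_iff)
    thus ?thesis unfolding eq by simp
  qed
  ultimately have "int P ^ 2 dvd 1 - x" by (simp add: coprime_dvd_mult_left_iff)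
  hence "int (P ^ 2) dvd int (y + 1)" by (simp add: x_def)
  thus ?thesis by (simp only: of_nat_dvd_iff)
qed

text \<open>Here \<open>g\<close> is a factor of \<open>l\<close> that is permitted to divide
  \<open>P - 1\<close>. Divisibility of \<open>a ^ l + 1\<close> reduces to that of
  \<open>a ^ g + 1\<close>, so only a fixed small exponent has to be examined. The general route has
  \<open>g = 1\<close>; larger \<open>g\<close> serve the exceptional small
  \<open>n\<close>.\<close>

lemma not_powerful_Omega_witness:
  fixes P g h l n a0 :: nat
  assumes P: "prime P" "P = g * h + 1" and l: "odd l" "g dvd l" "coprime l h" "\<not> P dvd l"
    and h: "even h \<or> P = 2"
    and a0: "a0 \<in> {1..n}" "P dvd a0 ^ g + 1" "\<not> P\<^sup>2 dvd a0 ^ g + 1"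
    and uniq: "\<And>a. a \<in> {1..n} \<Longrightarrow> P dvd a ^ g + 1 \<Longrightarrow> a = a0"
  shows "\<not> powerful (Omega l n)"
proof
  assume pow: "powerful (Omega l n)"
  obtain k where k: "l = g * k" using l by blast
  have kodd: "odd k" "\<not> P dvd k" using l k by auto
  have Om: "Omega l n = (a0 ^ l + 1) * (\<Prod>a\<in>{1..n}-{a0}. a ^ l + 1)"
    unfolding Omega_def using a0(1) by (intro prod.remove) auto
  have "\<not> P dvd (\<Prod>a\<in>{1..n}-{a0}. a ^ l + 1)"
  proof
    assume "P dvd (\<Prod>a\<in>{1..n}-{a0}. a ^ l + 1)"
    then obtain a where "a \<in> {1..n}-{a0}" "P dvd a ^ l + 1"
      using P(1) by (meson finite_Diff finite_atLeastAtMost prime_dvd_prod_iff)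
    thus False using power_plus_one_dvdD[OF P l(1,2,3) h, of a] uniq by blast
  qed
  hence cop: "coprime (P ^ 2) (\<Prod>a\<in>{1..n}-{a0}. a ^ l + 1)"
    using P(1) by (simp add: prime_imp_coprime)
  have "P dvd a0 ^ l + 1"
  proof -
    have "int (a0 ^ g) + 1 dvd int (a0 ^ g) ^ k + 1"
    proof -
      have "1 - (- int (a0 ^ g)) ^ k = (1 - - int (a0 ^ g)) * (\<Sum>i<k. (- int (a0 ^ g)) ^ i)"
        by (rule one_diff_power_eq)
      thus ?thesis using kodd(1) by (simp add: power_minus_odd add.commute)
    qed
    hence "int (a0 ^ g + 1) dvd int (a0 ^ l + 1)" by (simp add: k power_mult add.commute)
    hence "a0 ^ g + 1 dvd a0 ^ l + 1" by (simp only: of_nat_dvd_iff)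
    thus ?thesis using a0 by (meson dvd_trans)
  qed
  hence "P dvd Omega l n" unfolding Om by (rule dvd_mult2)
  hence "P ^ 2 dvd Omega l n" using pow P unfolding powerful_def by blast
  hence "P ^ 2 dvd a0 ^ l + 1" unfolding Om using cop coprime_dvd_mult_left_iff by blast
  hence "P ^ 2 dvd (a0 ^ g) ^ k + 1" by (simp add: k power_mult)
  thus False using square_dvd_power_plus_oneD[OF P(1) a0(2) kodd(2,1)] a0(3) by blast
qed

text \<open>The case \<open>g = 1\<close>: \<open>a + 1\<close> is a positive multiple of
  \<open>p\<close> below \<open>2 * p\<close>, hence equals \<open>p\<close>, and \<open>p\<close>
  is not divisible by its square.\<close>

lemma not_powerful_Omega_prime:
  fixes p l n :: nat
  assumes p: "prime p" "p \<le> n + 1" "n + 1 < 2 * p" and n: "n > 0"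
    and l: "odd l" "coprime l (p - 1)" "\<not> p dvd l"
  shows "\<not> powerful (Omega l n)"
proof (rule not_powerful_Omega_witness[where P = p and g = 1 and h = "p - 1" and ?a0.0 = "p - 1"])
  have "p > 1" using p prime_gt_1_nat by blast
  thus "p = 1 * (p - 1) + 1" "p - 1 \<in> {1..n}" "p dvd (p - 1) ^ 1 + 1" using p by auto
  show "\<not> p\<^sup>2 dvd (p - 1) ^ 1 + 1"
  proof
    assume "p\<^sup>2 dvd (p - 1) ^ 1 + 1"
    hence "p\<^sup>2 dvd p" using \<open>p > 1\<close> by simp
    hence "p * p \<le> p" using \<open>p > 1\<close> by (intro dvd_imp_le) (auto simp: power2_eq_square)
    thus False using \<open>p > 1\<close> by simp
  qed
  show "even (p - 1) \<or> p = 2" using p(1) prime_odd_nat[of p] \<open>p > 1\<close> by (cases "p = 2") auto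
  fix a assume a: "a \<in> {1..n}" "p dvd a ^ 1 + 1"
  then obtain j where j: "a + 1 = p * j" by auto
  have "j > 0" using j by (auto intro: Nat.gr0I)
  moreover have "p * j < p * 2" using a(1) j p(3) by (simp flip: j)
  hence "j < 2" by (simp only: mult_less_cancel1)
  ultimately have "j = 1" by simp
  thus "a = p - 1" using j by simp
qed (use p l in auto)

lemma three_prime_divisors:
  fixes l :: nat
  assumes "card (prime_factors l) \<le> 2" "l > 0" "prime p" "prime q" "prime r"
    "p dvd l" "q dvd l" "r dvd l" "p \<noteq> q" "p \<noteq> r" "q \<noteq> r"
  shows False
proof -
  have "{p, q, r} \<subseteq> prime_factors l" using assms by (auto simp: in_prime_factors_iff)
  hence "card {p, q, r} \<le> card (prime_factors l)" by (intro card_mono) auto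
  thus False using assms by simp
qed

section \<open>Primality certificates\<close>

text \<open>
  The certificates are stated over the integers because \<open>code_simp\<close> computes with natural
  numbers in unary.
\<close>

primrec no_odd_divisor_from :: "nat \<Rightarrow> int \<Rightarrow> int \<Rightarrow> bool" where
  "no_odd_divisor_from 0 d n \<longleftrightarrow> n < d * d"
| "no_odd_divisor_from (Suc f) d n \<longleftrightarrow> n mod d \<noteq> 0 \<and> no_odd_divisor_from f (d + 2) n"

lemma no_odd_divisor_fromD:
  assumes "no_odd_divisor_from f d n" "odd d" "d > 0" "odd q" "d \<le> q" "q * q \<le> n"
  shows "\<not> q dvd n"
  using assms
proof (induction f arbitrary: d)
  case 0
  have "d * d \<le> q * q" using 0 by (intro mult_mono) auto
  thus ?case using 0 by simp
next
  case (Suc f)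
  show ?case
  proof (cases "q = d")
    case True
    thus ?thesis using Suc.prems by (simp add: dvd_eq_mod_eq_0)
  next
    case False
    hence "d + 2 \<le> q" using Suc.prems by presburger
    thus ?thesis using Suc.prems by (intro Suc.IH[of "d + 2"]) auto
  qed
qed

lemma prime_by_trial_division:
  assumes cert: "N > 1 \<and> N mod 2 = 1 \<and> no_odd_divisor_from f 3 N" and n: "nat N = n"
  shows "prime n"
proof -
  have N: "N = int n" using cert n by auto
  have False if q: "prime q" "q dvd n" "q\<^sup>2 \<le> n" for q
  proof -
    have "int n mod 2 = 1" using cert N by simp
    hence "odd n" by presburger
    hence "odd q" using q by auto
    moreover have "q \<ge> 2" using q(1) prime_ge_2_nat by blast
    ultimately have "q \<ge> 3" by presburger
    moreover have "int q * int q \<le> N" using q(3) unfolding N power2_eq_square by (metis of_nat_le_iff of_nat_mult)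
    ultimately have "\<not> int q dvd N"
      using no_odd_divisor_fromD[of f 3 N "int q"] cert \<open>odd q\<close> by auto
    thus False using q(2) N by simp
  qed
  thus ?thesis unfolding prime_prime_factor_sqrt[of n] using cert N by auto
qed

text \<open>Binary exponentiation with accumulator \<open>y\<close>: the represented value is
  \<open>x ^ k * y\<close> modulo \<open>n\<close>. The first argument bounds the number of binary
  digits of \<open>k\<close>.\<close>

primrec powmod_aux :: "nat \<Rightarrow> int \<Rightarrow> int \<Rightarrow> int \<Rightarrow> int \<Rightarrow> int" where
  "powmod_aux 0 n x y k = y"
| "powmod_aux (Suc f) n x y k =
     powmod_aux f n (x * x mod n) (if k mod 2 = 1 then x * y mod n else y) (k div 2)"

lemma powmod_aux_cong:
  assumes "0 \<le> k" "k < 2 ^ f"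
  shows "[powmod_aux f n x y k = x ^ nat k * y] (mod n)"
  using assms
proof (induction f arbitrary: x y k)
  case (Suc f)
  let ?y = "if k mod 2 = 1 then x * y mod n else y"
  have "[powmod_aux f n (x * x mod n) ?y (k div 2) = (x * x mod n) ^ nat (k div 2) * ?y] (mod n)"
    using Suc.prems by (intro Suc.IH) auto
  also have "[(x * x mod n) ^ nat (k div 2) * ?y =
      (x * x) ^ nat (k div 2) * (if k mod 2 = 1 then x * y else y)] (mod n)"
    by (intro cong_mult cong_pow) auto
  also have "(x * x) ^ nat (k div 2) * (if k mod 2 = 1 then x * y else y) = x ^ nat k * y"
  proof -
    have "nat k = 2 * nat (k div 2) + (if k mod 2 = 1 then 1 else 0)"
    proof -
      obtain j where j: "k div 2 = int j" using Suc.prems(1) zero_le_imp_eq_int[of "k div 2"] by auto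
      have k: "k = 2 * int j + k mod 2" unfolding j[symmetric] by simp
      show ?thesis
      proof (cases "k mod 2 = 1")
        case True
        thus ?thesis using k by (simp add: j)
      next
        case False
        hence "k mod 2 = 0" by presburger
        thus ?thesis using k by (simp add: j)
      qed
    qed
    moreover have "x ^ (2 * j) = (x * x) ^ j" for j by (simp add: power_mult power2_eq_square)
    ultimately show ?thesis by (simp add: power_add)
  qed
  finally show ?case by simp
qed simp

text \<open>Pocklington's criterion with the power of 2 in \<open>N - 1\<close> as factored part,
  which exceeds the square root because \<open>K < 2 ^ Suc e\<close>. The single value
  \<open>a ^ ((N - 1) / 2) = - 1\<close> gives both the Fermat condition, by squaring, and the
  coprimality condition at the prime 2. Primes of this shape also display the odd part of
  \<open>p - 1\<close>.\<close>

lemma proth: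
  assumes cert: "N = K * 2 ^ Suc e + 1 \<and> 0 < K \<and> K < 2 ^ Suc e \<and> K * 2 ^ e < 2 ^ f \<and>
      powmod_aux f N (int a) 1 (K * 2 ^ e) = N - 1" and n: "nat N = n"
  shows "prime n"
proof (rule pocklington[where q = "2 ^ Suc e" and r = "nat K" and a = a])
  define k where "k = nat K"
  define h where "h = k * 2 ^ e"
  have K: "K = int k" using cert by (simp add: k_def)
  have N: "N = int n" using n cert by auto
  have "N = int (k * 2 ^ Suc e + 1)" using cert by (simp add: K)
  hence nk: "n = k * 2 ^ Suc e + 1" unfolding N by (simp only: of_nat_eq_iff)
  have "int k < int (2 ^ Suc e)" using cert by (simp add: K)
  hence k2: "k < 2 ^ Suc e" by (simp only: of_nat_less_iff)
  have kpos: "k > 0" using cert by (simp add: K)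
  have nh: "n = 2 * h + 1" "h > 0" using nk kpos by (auto simp: h_def)
  show n2: "n \<ge> 2" using nh by simp
  show "n - 1 = 2 ^ Suc e * nat K" using nk by (simp add: k_def)
  have "k * 2 ^ Suc e + 1 \<le> (k + 1) * 2 ^ Suc e" by simp
  also have "\<dots> \<le> 2 ^ Suc e * 2 ^ Suc e" using k2 by (intro mult_right_mono) auto
  finally show "n \<le> (2 ^ Suc e)\<^sup>2" by (simp add: nk power2_eq_square)
  have ih: "int h = K * 2 ^ e" by (simp add: h_def K)
  have "powmod_aux f N (int a) 1 (int h) = N - 1" using cert unfolding ih by blast
  moreover have "[powmod_aux f N (int a) 1 (int h) = int a ^ nat (int h) * 1] (mod N)"
    using cert unfolding ih by (intro powmod_aux_cong) auto
  ultimately have "[int n - 1 = int a ^ h] (mod int n)" by (simp only: nat_int mult_1_right N)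
  hence "int n dvd int n - 1 - int a ^ h" by (simp only: cong_iff_dvd_diff)
  hence "int n dvd int n - (int n - 1 - int a ^ h)" by (rule dvd_diff[OF dvd_refl])
  hence "int n dvd int a ^ h + 1" by (simp add: algebra_simps)
  hence "int n dvd int (a ^ h + 1)" by (simp add: add.commute)
  hence dvd: "n dvd a ^ h + 1" by (simp only: of_nat_dvd_iff)
  have a0: "a ^ h > 0"
    using dvd n2 by (cases "a ^ h = 0") auto
  have "int n dvd (int a ^ h + 1) * (int a ^ h - 1)"
    using \<open>int n dvd int a ^ h + 1\<close> by (rule dvd_mult2)
  also have "(int a ^ h + 1) * (int a ^ h - 1) = int a ^ (n - 1) - 1"
    by (simp add: nh algebra_simps mult_2 mult_2_right power_add)
  finally have "[int (a ^ (n - 1)) = int 1] (mod int n)" by (simp add: cong_iff_dvd_diff)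
  thus "[a ^ (n - 1) = 1] (mod n)" by (simp only: cong_int_iff)
  show "\<forall>p. prime p \<and> p dvd 2 ^ Suc e \<longrightarrow> coprime (a ^ ((n - 1) div p) - 1) n"
  proof (intro allI impI)
    fix p :: nat assume p: "prime p \<and> p dvd 2 ^ Suc e"
    hence "p dvd 2" using prime_dvd_power by blast
    hence "p = 2" using p by (simp add: primes_dvd_imp_eq)
    \<comment> \<open>A common divisor also divides \<open>a ^ h + 1\<close>, hence it divides 2;
      but \<open>n\<close> is odd.\<close>
    moreover have "coprime (a ^ h - 1) n"
    proof (rule coprimeI)
      fix d assume d: "d dvd a ^ h - 1" "d dvd n"
      have "d dvd a ^ h + 1" using d dvd by (meson dvd_trans)
      hence "d dvd (a ^ h + 1) - (a ^ h - 1)" using d(1) by (rule dvd_diff_nat)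
      hence "d dvd 2" using a0 by simp
      hence "d dvd n - 2 * h" using d(2) by (meson dvd_diff_nat dvd_mult2)
      thus "is_unit d" by (simp add: nh)
    qed
    ultimately show "coprime (a ^ ((n - 1) div p) - 1) n" by (simp add: nh)
  qed
qed

section \<open>Primes for the explicit range\<close>

lemma prime_17: "prime (17::nat)"
  by (rule prime_by_trial_division[of 17 1]) (code_simp, simp)
lemma prime_19: "prime (19::nat)"
  by (rule prime_by_trial_division[of 19 1]) (code_simp, simp)
lemma prime_23: "prime (23::nat)"
  by (rule prime_by_trial_division[of 23 1]) (code_simp, simp)
lemma prime_29: "prime (29::nat)"
  by (rule prime_by_trial_division[of 29 2]) (code_simp, simp)
lemma prime_31: "prime (31::nat)"
  by (rule prime_by_trial_division[of 31 2]) (code_simp, simp)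
lemma prime_37: "prime (37::nat)"
  by (rule prime_by_trial_division[of 37 2]) (code_simp, simp)
lemma prime_41: "prime (41::nat)"
  by (rule prime_by_trial_division[of 41 2]) (code_simp, simp)
lemma prime_43: "prime (43::nat)"
  by (rule prime_by_trial_division[of 43 2]) (code_simp, simp)
lemma prime_47: "prime (47::nat)"
  by (rule prime_by_trial_division[of 47 2]) (code_simp, simp)
lemma prime_53: "prime (53::nat)"
  by (rule prime_by_trial_division[of 53 3]) (code_simp, simp)
lemma prime_71: "prime (71::nat)"
  by (rule prime_by_trial_division[of 71 3]) (code_simp, simp)
lemma prime_79: "prime (79::nat)"
  by (rule prime_by_trial_division[of 79 3]) (code_simp, simp)
lemma prime_83: "prime (83::nat)"
  by (rule prime_by_trial_division[of 83 4]) (code_simp, simp)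
lemma prime_131: "prime (131::nat)"
  by (rule prime_by_trial_division[of 131 5]) (code_simp, simp)
lemma prime_137: "prime (137::nat)"
  by (rule prime_by_trial_division[of 137 5]) (code_simp, simp)
lemma prime_139: "prime (139::nat)"
  by (rule prime_by_trial_division[of 139 5]) (code_simp, simp)
lemma prime_239: "prime (239::nat)"
  by (rule prime_by_trial_division[of 239 7]) (code_simp, simp)
lemma prime_251: "prime (251::nat)"
  by (rule prime_by_trial_division[of 251 7]) (code_simp, simp)
lemma prime_257: "prime (257::nat)"
  by (rule prime_by_trial_division[of 257 7]) (code_simp, simp)
lemma prime_461: "prime (461::nat)"
  by (rule prime_by_trial_division[of 461 10]) (code_simp, simp)
lemma prime_463: "prime (463::nat)"
  by (rule prime_by_trial_division[of 463 10]) (code_simp, simp)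
lemma prime_467: "prime (467::nat)"
  by (rule prime_by_trial_division[of 467 10]) (code_simp, simp)
lemma prime_887: "prime (887::nat)"
  by (rule prime_by_trial_division[of 887 14]) (code_simp, simp)
lemma prime_911: "prime (911::nat)"
  by (rule prime_by_trial_division[of 911 14]) (code_simp, simp)
lemma prime_919: "prime (919::nat)"
  by (rule prime_by_trial_division[of 919 14]) (code_simp, simp)
lemma prime_1721: "prime (1721::nat)"
  by (rule prime_by_trial_division[of 1721 20]) (code_simp, simp)
lemma prime_1733: "prime (1733::nat)"
  by (rule prime_by_trial_division[of 1733 20]) (code_simp, simp)
lemma prime_1759: "prime (1759::nat)"
  by (rule prime_by_trial_division[of 1759 20]) (code_simp, simp)
lemma prime_3391: "prime (3391::nat)"
  by (rule prime_by_trial_division[of 3391 28]) (code_simp, simp)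
lemma prime_3407: "prime (3407::nat)"
  by (rule prime_by_trial_division[of 3407 28]) (code_simp, simp)
lemma prime_3413: "prime (3413::nat)"
  by (rule prime_by_trial_division[of 3413 28]) (code_simp, simp)
lemma prime_6761: "prime (6761::nat)"
  by (rule prime_by_trial_division[of 6761 40]) (code_simp, simp)
lemma prime_6763: "prime (6763::nat)"
  by (rule prime_by_trial_division[of 6763 40]) (code_simp, simp)
lemma prime_6779: "prime (6779::nat)"
  by (rule prime_by_trial_division[of 6779 40]) (code_simp, simp)
text \<open>The arguments are \<open>N\<close>, \<open>K\<close>, \<open>e\<close>, the digit bound
  30, which suffices for \<open>(N - 1) / 2 < 2 ^ 30\<close>, and a quadratic non-residue as
  base.\<close>

lemma prime_12161: "prime (12161::nat)"
  by (rule proth[of 12161 95 6 30 3]) (code_simp, simp)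
lemma prime_12289: "prime (12289::nat)"
  by (rule proth[of 12289 3 11 30 11]) (code_simp, simp)
lemma prime_13313: "prime (13313::nat)"
  by (rule proth[of 13313 13 9 30 3]) (code_simp, simp)
lemma prime_19457: "prime (19457::nat)"
  by (rule proth[of 19457 19 9 30 3]) (code_simp, simp)
lemma prime_23041: "prime (23041::nat)"
  by (rule proth[of 23041 45 8 30 11]) (code_simp, simp)
lemma prime_23297: "prime (23297::nat)"
  by (rule proth[of 23297 91 7 30 3]) (code_simp, simp)
lemma prime_36353: "prime (36353::nat)"
  by (rule proth[of 36353 71 8 30 3]) (code_simp, simp)
lemma prime_37633: "prime (37633::nat)"
  by (rule proth[of 37633 147 7 30 5]) (code_simp, simp)
lemma prime_37889: "prime (37889::nat)"
  by (rule proth[of 37889 37 9 30 3]) (code_simp, simp)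
lemma prime_65537: "prime (65537::nat)"
  by (rule proth[of 65537 1 15 30 3]) (code_simp, simp)
lemma prime_67073: "prime (67073::nat)"
  by (rule proth[of 67073 131 8 30 3]) (code_simp, simp)
lemma prime_70657: "prime (70657::nat)"
  by (rule proth[of 70657 69 9 30 5]) (code_simp, simp)
lemma prime_119809: "prime (119809::nat)"
  by (rule proth[of 119809 117 9 30 11]) (code_simp, simp)
lemma prime_120833: "prime (120833::nat)"
  by (rule proth[of 120833 59 10 30 3]) (code_simp, simp)
lemma prime_125441: "prime (125441::nat)"
  by (rule proth[of 125441 245 8 30 3]) (code_simp, simp)
lemma prime_228353: "prime (228353::nat)"
  by (rule proth[of 228353 223 9 30 3]) (code_simp, simp)
lemma prime_232961: "prime (232961::nat)"
  by (rule proth[of 232961 455 8 30 3]) (code_simp, simp)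
lemma prime_235009: "prime (235009::nat)"
  by (rule proth[of 235009 459 8 30 7]) (code_simp, simp)
lemma prime_417793: "prime (417793::nat)"
  by (rule proth[of 417793 51 12 30 5]) (code_simp, simp)
lemma prime_428033: "prime (428033::nat)"
  by (rule proth[of 428033 209 10 30 3]) (code_simp, simp)
lemma prime_455681: "prime (455681::nat)"
  by (rule proth[of 455681 445 9 30 3]) (code_simp, simp)
lemma prime_812033: "prime (812033::nat)"
  by (rule proth[of 812033 793 9 30 3]) (code_simp, simp)
lemma prime_817153: "prime (817153::nat)"
  by (rule proth[of 817153 399 10 30 5]) (code_simp, simp)
lemma prime_833537: "prime (833537::nat)"
  by (rule proth[of 833537 407 10 30 3]) (code_simp, simp)
lemma prime_1589249: "prime (1589249::nat)"
  by (rule proth[of 1589249 97 13 30 3]) (code_simp, simp)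
lemma prime_1595393: "prime (1595393::nat)"
  by (rule proth[of 1595393 779 10 30 3]) (code_simp, simp)
lemma prime_1607681: "prime (1607681::nat)"
  by (rule proth[of 1607681 785 10 30 3]) (code_simp, simp)
lemma prime_3127297: "prime (3127297::nat)"
  by (rule proth[of 3127297 1527 10 30 5]) (code_simp, simp)
lemma prime_3168257: "prime (3168257::nat)"
  by (rule proth[of 3168257 1547 10 30 3]) (code_simp, simp)
lemma prime_3174401: "prime (3174401::nat)"
  by (rule proth[of 3174401 775 11 30 3]) (code_simp, simp)
lemma prime_6209537: "prime (6209537::nat)"
  by (rule proth[of 6209537 379 13 30 3]) (code_simp, simp)
lemma prime_6234113: "prime (6234113::nat)"
  by (rule proth[of 6234113 761 12 30 3]) (code_simp, simp)
lemma prime_6254593: "prime (6254593::nat)"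
  by (rule proth[of 6254593 1527 11 30 5]) (code_simp, simp)
lemma prime_12230657: "prime (12230657::nat)"
  by (rule proth[of 12230657 1493 12 30 3]) (code_simp, simp)
lemma prime_12361729: "prime (12361729::nat)"
  by (rule proth[of 12361729 1509 12 30 11]) (code_simp, simp)
lemma prime_12390401: "prime (12390401::nat)"
  by (rule proth[of 12390401 3025 11 30 3]) (code_simp, simp)
lemma prime_24035329: "prime (24035329::nat)"
  by (rule proth[of 24035329 1467 13 30 7]) (code_simp, simp)
lemma prime_24150017: "prime (24150017::nat)"
  by (rule proth[of 24150017 737 14 30 3]) (code_simp, simp)
lemma prime_24199169: "prime (24199169::nat)"
  by (rule proth[of 24199169 1477 13 30 3]) (code_simp, simp)
lemma prime_47718401: "prime (47718401::nat)"
  by (rule proth[of 47718401 5825 12 30 3]) (code_simp, simp)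
lemma prime_47915009: "prime (47915009::nat)"
  by (rule proth[of 47915009 5849 12 30 3]) (code_simp, simp)
lemma prime_48070657: "prime (48070657::nat)"
  by (rule proth[of 48070657 1467 14 30 5]) (code_simp, simp)
lemma prime_94519297: "prime (94519297::nat)"
  by (rule proth[of 94519297 5769 13 30 5]) (code_simp, simp)
lemma prime_95027201: "prime (95027201::nat)"
  by (rule proth[of 95027201 725 16 30 3]) (code_simp, simp)
lemma prime_95076353: "prime (95076353::nat)"
  by (rule proth[of 95076353 5803 13 30 3]) (code_simp, simp)
lemma prime_188465153: "prime (188465153::nat)"
  by (rule proth[of 188465153 11503 13 30 3]) (code_simp, simp)
lemma prime_188612609: "prime (188612609::nat)"
  by (rule proth[of 188612609 1439 16 30 3]) (code_simp, simp)
lemma prime_188989441: "prime (188989441::nat)"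
  by (rule proth[of 188989441 11535 13 30 19]) (code_simp, simp)
lemma prime_376209409: "prime (376209409::nat)"
  by (rule proth[of 376209409 11481 14 30 23]) (code_simp, simp)
lemma prime_376569857: "prime (376569857::nat)"
  by (rule proth[of 376569857 2873 16 30 3]) (code_simp, simp)
lemma prime_376668161: "prime (376668161::nat)"
  by (rule proth[of 376668161 11495 14 30 3]) (code_simp, simp)
lemma prime_751501313: "prime (751501313::nat)"
  by (rule proth[of 751501313 11467 15 30 3]) (code_simp, simp)
lemma prime_751599617: "prime (751599617::nat)"
  by (rule proth[of 751599617 22937 14 30 3]) (code_simp, simp)
lemma prime_752189441: "prime (752189441::nat)"
  by (rule proth[of 752189441 22955 14 30 3]) (code_simp, simp)

section \<open>The range below \<open>2 ^ 30\<close>\<close>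

text \<open>If all three primes failed, each number \<open>k * p\<close> would contain a prime
  factor of \<open>l\<close>, and coprimality would make these three distinct. The power of 2 is
  split off because every \<open>p - 1\<close> is even, while an odd \<open>l\<close> ignores
  it.\<close>

lemma not_powerful_Omega_three_primes:
  fixes l n p1 p2 p3 :: nat
  assumes l: "l > 0" "odd l" "card (prime_factors l) \<le> 2"
    and p: "prime p1" "prime p2" "prime p3"
    and k: "p1 = k1 * 2 ^ e1 + 1" "p2 = k2 * 2 ^ e2 + 1" "p3 = k3 * 2 ^ e3 + 1"
    and cop: "gcd (k1 * p1) (k2 * p2) = 1" "gcd (k1 * p1) (k3 * p3) = 1" "gcd (k2 * p2) (k3 * p3) = 1"
    and n: "p1 \<le> p2" "p2 \<le> p3" "p3 \<le> n + 1" "n + 1 < 2 * p1"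
  shows "\<not> powerful (Omega l n)"
proof (rule ccontr)
  assume pow: "\<not> \<not> powerful (Omega l n)"
  have npos: "n > 0" using n prime_gt_1_nat[OF p(1)] by auto
  have *: "\<exists>s. prime s \<and> s dvd l \<and> s dvd k * q"
    if "prime q" "q = k * 2 ^ e + 1" "q \<le> n + 1" "n + 1 < 2 * q" for q k e
  proof (rule ccontr)
    assume neg: "\<not> (\<exists>s. prime s \<and> s dvd l \<and> s dvd k * q)"
    have "coprime l k"
    proof (rule ccontr)
      assume "\<not> coprime l k"
      hence "gcd l k \<noteq> 1" using coprime_iff_gcd_eq_1 by blast
      then obtain s where "prime s" "s dvd gcd l k" using prime_factor_nat by blast
      hence "s dvd l" "s dvd k * q" by (meson gcd_dvd1 gcd_dvd2 dvd_trans dvd_mult2)+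
      thus False using neg \<open>prime s\<close> by blast
    qed
    hence "coprime l (q - 1)" using l that by simp
    moreover have "\<not> q dvd l" using neg that(1) dvd_triv_right by blast
    ultimately show False using not_powerful_Omega_prime[OF that(1,3,4) npos l(2)] pow by blast
  qed
  obtain s1 where s1: "prime s1" "s1 dvd l" "s1 dvd k1 * p1" using *[OF p(1) k(1)] n by auto
  obtain s2 where s2: "prime s2" "s2 dvd l" "s2 dvd k2 * p2" using *[OF p(2) k(2)] n by auto
  obtain s3 where s3: "prime s3" "s3 dvd l" "s3 dvd k3 * p3" using *[OF p(3) k(3)] n by auto
  have ne: "s \<noteq> t" if "prime s" "s dvd x" "t dvd y" "gcd x y = 1" for s t x y :: nat
    using that by (metis gcd_greatest nat_dvd_1_iff_1 not_prime_1)
  show False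
    using three_prime_divisors[OF l(3,1) s1(1) s2(1) s3(1) s1(2) s2(2) s3(2)]
      ne[OF s1(1,3) s2(3) cop(1)] ne[OF s1(1,3) s3(3) cop(2)] ne[OF s2(1,3) s3(3) cop(3)] by blast
qed

lemma not_powerful_Omega_below:
  fixes l n :: nat
  assumes l: "l > 0" "odd l" "card (prime_factors l) \<le> 2" and n: "23 \<le> n + 1" "n + 1 < 2 ^ 30"
  shows "\<not> powerful (Omega l n)"
proof -
  note rule = not_powerful_Omega_three_primes[OF l]
  \<comment> \<open>Each bound is twice the smallest prime of its triple, and the largest prime of
    the next triple does not exceed it, so no gap arises. The last bound is beyond
    \<open>2 ^ 30\<close>.\<close>
  have upto0: ?thesis if "n + 1 < 34"
    using that n by (intro rule[OF prime_17 prime_19 prime_23, of 1 4 9 1 11 1]) (simp_all add: gcd_non_0_nat)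
  have upto1: ?thesis if "n + 1 < 46"
  proof (cases "n + 1 < 34")
    case False
    thus ?thesis using that
      by (intro rule[OF prime_23 prime_29 prime_31, of 11 1 7 2 15 1])
        (simp_all add: gcd_non_0_nat)
  qed (fact upto0)
  have upto2: ?thesis if "n + 1 < 58"
  proof (cases "n + 1 < 46")
    case False
    thus ?thesis using that
      by (intro rule[OF prime_29 prime_37 prime_41, of 7 2 9 2 5 3])
        (simp_all add: gcd_non_0_nat)
  qed (fact upto1)
  have upto3: ?thesis if "n + 1 < 86"
  proof (cases "n + 1 < 58")
    case False
    thus ?thesis using that
      by (intro rule[OF prime_43 prime_47 prime_53, of 21 1 23 1 13 2])
        (simp_all add: gcd_non_0_nat)
  qed (fact upto2)
  have upto4: ?thesis if "n + 1 < 142"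
  proof (cases "n + 1 < 86")
    case False
    thus ?thesis using that
      by (intro rule[OF prime_71 prime_79 prime_83, of 35 1 39 1 41 1])
        (simp_all add: gcd_non_0_nat)
  qed (fact upto3)
  have upto5: ?thesis if "n + 1 < 262"
  proof (cases "n + 1 < 142")
    case False
    thus ?thesis using that
      by (intro rule[OF prime_131 prime_137 prime_139, of 65 1 17 3 69 1])
        (simp_all add: gcd_non_0_nat)
  qed (fact upto4)
  have upto6: ?thesis if "n + 1 < 478"
  proof (cases "n + 1 < 262")
    case False
    thus ?thesis using that
      by (intro rule[OF prime_239 prime_251 prime_257, of 119 1 125 1 1 8])
        (simp_all add: gcd_non_0_nat)
  qed (fact upto5)
  have upto7: ?thesis if "n + 1 < 922"
  proof (cases "n + 1 < 478")
    case False
    thus ?thesis using that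
      by (intro rule[OF prime_461 prime_463 prime_467, of 115 2 231 1 233 1])
        (simp_all add: gcd_non_0_nat)
  qed (fact upto6)
  have upto8: ?thesis if "n + 1 < 1774"
  proof (cases "n + 1 < 922")
    case False
    thus ?thesis using that
      by (intro rule[OF prime_887 prime_911 prime_919, of 443 1 455 1 459 1])
        (simp_all add: gcd_non_0_nat)
  qed (fact upto7)
  have upto9: ?thesis if "n + 1 < 3442"
  proof (cases "n + 1 < 1774")
    case False
    thus ?thesis using that
      by (intro rule[OF prime_1721 prime_1733 prime_1759, of 215 3 433 2 879 1])
        (simp_all add: gcd_non_0_nat)
  qed (fact upto8)
  have upto10: ?thesis if "n + 1 < 6782"
  proof (cases "n + 1 < 3442")
    case False
    thus ?thesis using that
      by (intro rule[OF prime_3391 prime_3407 prime_3413, of 1695 1 1703 1 853 2])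
        (simp_all add: gcd_non_0_nat)
  qed (fact upto9)
  have upto11: ?thesis if "n + 1 < 13522"
  proof (cases "n + 1 < 6782")
    case False
    thus ?thesis using that
      by (intro rule[OF prime_6761 prime_6763 prime_6779, of 845 3 3381 1 3389 1])
        (simp_all add: gcd_non_0_nat)
  qed (fact upto10)
  have upto12: ?thesis if "n + 1 < 24322"
  proof (cases "n + 1 < 13522")
    case False
    thus ?thesis using that
      by (intro rule[OF prime_12161 prime_12289 prime_13313, of 95 7 3 12 13 10])
        (simp_all add: gcd_non_0_nat)
  qed (fact upto11)
  have upto13: ?thesis if "n + 1 < 38914"
  proof (cases "n + 1 < 24322")
    case False
    thus ?thesis using that
      by (intro rule[OF prime_19457 prime_23041 prime_23297, of 19 10 45 9 91 8])
        (simp_all add: gcd_non_0_nat)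
  qed (fact upto12)
  have upto14: ?thesis if "n + 1 < 72706"
  proof (cases "n + 1 < 38914")
    case False
    thus ?thesis using that
      by (intro rule[OF prime_36353 prime_37633 prime_37889, of 71 9 147 8 37 10])
        (simp_all add: gcd_non_0_nat)
  qed (fact upto13)
  have upto15: ?thesis if "n + 1 < 131074"
  proof (cases "n + 1 < 72706")
    case False
    thus ?thesis using that
      by (intro rule[OF prime_65537 prime_67073 prime_70657, of 1 16 131 9 69 10])
        (simp_all add: gcd_non_0_nat)
  qed (fact upto14)
  have upto16: ?thesis if "n + 1 < 239618"
  proof (cases "n + 1 < 131074")
    case False
    thus ?thesis using that
      by (intro rule[OF prime_119809 prime_120833 prime_125441, of 117 10 59 11 245 9])
        (simp_all add: gcd_non_0_nat)
  qed (fact upto15)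
  have upto17: ?thesis if "n + 1 < 456706"
  proof (cases "n + 1 < 239618")
    case False
    thus ?thesis using that
      by (intro rule[OF prime_228353 prime_232961 prime_235009, of 223 10 455 9 459 9])
        (simp_all add: gcd_non_0_nat)
  qed (fact upto16)
  have upto18: ?thesis if "n + 1 < 835586"
  proof (cases "n + 1 < 456706")
    case False
    thus ?thesis using that
      by (intro rule[OF prime_417793 prime_428033 prime_455681, of 51 13 209 11 445 10])
        (simp_all add: gcd_non_0_nat)
  qed (fact upto17)
  have upto19: ?thesis if "n + 1 < 1624066"
  proof (cases "n + 1 < 835586")
    case False
    thus ?thesis using that
      by (intro rule[OF prime_812033 prime_817153 prime_833537, of 793 10 399 11 407 11])
        (simp_all add: gcd_non_0_nat)
  qed (fact upto18)
  have upto20: ?thesis if "n + 1 < 3178498"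
  proof (cases "n + 1 < 1624066")
    case False
    thus ?thesis using that
      by (intro rule[OF prime_1589249 prime_1595393 prime_1607681, of 97 14 779 11 785 11])
        (simp_all add: gcd_non_0_nat)
  qed (fact upto19)
  have upto21: ?thesis if "n + 1 < 6254594"
  proof (cases "n + 1 < 3178498")
    case False
    thus ?thesis using that
      by (intro rule[OF prime_3127297 prime_3168257 prime_3174401, of 1527 11 1547 11 775 12])
        (simp_all add: gcd_non_0_nat)
  qed (fact upto20)
  have upto22: ?thesis if "n + 1 < 12419074"
  proof (cases "n + 1 < 6254594")
    case False
    thus ?thesis using that
      by (intro rule[OF prime_6209537 prime_6234113 prime_6254593, of 379 14 761 13 1527 12])
        (simp_all add: gcd_non_0_nat)
  qed (fact upto21)
  have upto23: ?thesis if "n + 1 < 24461314"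
  proof (cases "n + 1 < 12419074")
    case False
    thus ?thesis using that
      by (intro rule[OF prime_12230657 prime_12361729 prime_12390401, of 1493 13 1509 13 3025 12])
        (simp_all add: gcd_non_0_nat)
  qed (fact upto22)
  have upto24: ?thesis if "n + 1 < 48070658"
  proof (cases "n + 1 < 24461314")
    case False
    thus ?thesis using that
      by (intro rule[OF prime_24035329 prime_24150017 prime_24199169, of 1467 14 737 15 1477 14])
        (simp_all add: gcd_non_0_nat)
  qed (fact upto23)
  have upto25: ?thesis if "n + 1 < 95436802"
  proof (cases "n + 1 < 48070658")
    case False
    thus ?thesis using that
      by (intro rule[OF prime_47718401 prime_47915009 prime_48070657, of 5825 13 5849 13 1467 15])
        (simp_all add: gcd_non_0_nat)
  qed (fact upto24)
  have upto26: ?thesis if "n + 1 < 189038594"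
  proof (cases "n + 1 < 95436802")
    case False
    thus ?thesis using that
      by (intro rule[OF prime_94519297 prime_95027201 prime_95076353, of 5769 14 725 17 5803 14])
        (simp_all add: gcd_non_0_nat)
  qed (fact upto25)
  have upto27: ?thesis if "n + 1 < 376930306"
  proof (cases "n + 1 < 189038594")
    case False
    thus ?thesis using that
      by (intro rule[OF prime_188465153 prime_188612609 prime_188989441, of 11503 14 1439 17 11535 14])
        (simp_all add: gcd_non_0_nat)
  qed (fact upto26)
  have upto28: ?thesis if "n + 1 < 752418818"
  proof (cases "n + 1 < 376930306")
    case False
    thus ?thesis using that
      by (intro rule[OF prime_376209409 prime_376569857 prime_376668161, of 11481 15 2873 17 11495 15])
        (simp_all add: gcd_non_0_nat)
  qed (fact upto27)
  have upto29: ?thesis if "n + 1 < 1503002626"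
  proof (cases "n + 1 < 752418818")
    case False
    thus ?thesis using that
      by (intro rule[OF prime_751501313 prime_751599617 prime_752189441, of 11467 16 22937 15 22955 15])
        (simp_all add: gcd_non_0_nat)
  qed (fact upto28)
  show ?thesis using upto29 n by simp
qed

section \<open>Certificates and case analysis for \<open>n \<le> 21\<close>\<close>

primrec only_root :: "nat \<Rightarrow> int \<Rightarrow> int \<Rightarrow> nat \<Rightarrow> int \<Rightarrow> bool" where
  "only_root 0 a P g r \<longleftrightarrow> True"
| "only_root (Suc f) a P g r \<longleftrightarrow> ((a ^ g + 1) mod P = 0 \<longrightarrow> a = r) \<and> only_root f (a + 1) P g r"

lemma only_rootD:
  assumes "only_root f b P g r" "b \<le> a" "a < b + int f" "P dvd a ^ g + 1"
  shows "a = r"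
  using assms
proof (induction f arbitrary: b)
  case (Suc f)
  show ?case
  proof (cases "a = b")
    case True
    thus ?thesis using Suc.prems by (simp add: dvd_eq_mod_eq_0)
  next
    case False
    thus ?thesis using Suc.prems by (intro Suc.IH[of "b + 1"]) auto
  qed
qed simp

text \<open>The search starts at 2 because \<open>a = 1\<close> gives the value 2, which
  \<open>P > 2\<close> cannot divide; \<open>f\<close> steps reach \<open>f + 1\<close>, hence the
  condition on \<open>n\<close>. The instances below list \<open>P\<close>, \<open>r\<close>,
  \<open>g\<close>, \<open>f\<close>, \<open>h\<close> in this order.\<close>

lemma not_powerful_Omega_cert:
  fixes l n f g h p :: nat
  assumes cert:
      "P > 2 \<and> r > 0 \<and> (r ^ g + 1) mod P = 0 \<and> (r ^ g + 1) mod (P * P) \<noteq> 0 \<and> only_root f 2 P g r"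
      "P = int (g * h) + 1 \<and> even h"
    and P: "prime p" "nat P = p"
    and l: "odd l" "g dvd l" "coprime l h" "\<not> p dvd l"
    and n: "nat r \<le> n" "n \<le> f + 1"
  shows "\<not> powerful (Omega l n)"
proof -
  define a0 where "a0 = nat r"
  have int: "P = int p" "r = int a0" using cert P by (auto simp: a0_def)
  show ?thesis
  proof (rule not_powerful_Omega_witness[where P = p and ?a0.0 = a0 and g = g and h = h])
    have "int p = int (g * h + 1)" using cert by (simp add: int)
    thus "p = g * h + 1" by (simp only: of_nat_eq_iff)
    show "a0 \<in> {1..n}" using cert n by (auto simp: a0_def)
    have "int p dvd int (a0 ^ g + 1)" using cert by (simp add: int dvd_eq_mod_eq_0 add.commute)
    thus "p dvd a0 ^ g + 1" by (simp only: of_nat_dvd_iff)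
    have "\<not> int (p\<^sup>2) dvd int (a0 ^ g + 1)"
      using cert by (simp add: int dvd_eq_mod_eq_0 add.commute power2_eq_square)
    thus "\<not> p\<^sup>2 dvd a0 ^ g + 1" by (simp only: of_nat_dvd_iff not_False_eq_True)
    fix a assume a: "a \<in> {1..n}" "p dvd a ^ g + 1"
    have "a \<noteq> 1" using a(2) cert int by (auto dest: dvd_imp_le)
    moreover have "int p dvd int (a ^ g + 1)" using a(2) by (simp only: of_nat_dvd_iff)
    ultimately have "int a = r"
      using a(1) n cert by (intro only_rootD[of f 2 P g r]) (auto simp: int add.commute)
    thus "a = a0" by (simp add: int)
  qed (use P l cert in auto)
qed

lemma not_powerful_Omega_small:
  fixes l n :: nat
  assumes l: "l > 0" "odd l" "card (prime_factors l) \<le> 2" and n: "n > 0" "n \<le> 21"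
  shows "\<not> powerful (Omega l n)"
proof -
  note three = three_prime_divisors[OF l(3,1)]
  have cop: "coprime l s \<longleftrightarrow> \<not> s dvd l" if "prime s" for s
    using that by (metis coprime_commute prime_imp_coprime coprime_absorb_left not_prime_unit)
  have cop2: "coprime l 2" using l(2) by simp
  note prime = not_powerful_Omega_prime[OF _ _ _ n(1) l(2)]
  have pr: "prime (3::nat)" "prime (5::nat)" "prime (7::nat)" "prime (11::nat)" "prime (13::nat)"
    "prime (17::nat)" "prime (19::nat)" "prime (41::nat)" "prime (43::nat)" "prime (89::nat)"
    "prime (397::nat)" "prime (449::nat)" "prime (547::nat)"
    by (simp, simp, simp, simp, simp, simp, simp, simp, simp,
        rule prime_by_trial_division[of 89 4], code_simp, simp,
        rule prime_by_trial_division[of 397 9], code_simp, simp,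
        rule prime_by_trial_division[of 449 10], code_simp, simp,
        rule prime_by_trial_division[of 547 11], code_simp, simp)
  note cp = cop[OF pr(1)] cop[OF pr(2)] cop[OF pr(3)] cop[OF pr(4)] cop[OF pr(5)] cop[OF pr(6)] cop[OF pr(7)]
  have c4: "coprime l (2 ^ k)" for k using l(2) by simp
  have h: "coprime l 4" "coprime l 8" "coprime l 16" "coprime l 64"
    "coprime l 6 \<longleftrightarrow> \<not> 3 dvd l" "coprime l 10 \<longleftrightarrow> \<not> 5 dvd l" "coprime l 12 \<longleftrightarrow> \<not> 3 dvd l"
    "coprime l 14 \<longleftrightarrow> \<not> 7 dvd l" "coprime l 18 \<longleftrightarrow> \<not> 3 dvd l" "coprime l 26 \<longleftrightarrow> \<not> 13 dvd l"
    "coprime l 36 \<longleftrightarrow> \<not> 3 dvd l" "coprime l 78 \<longleftrightarrow> \<not> 3 dvd l \<and> \<not> 13 dvd l"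
    using c4[of 2] c4[of 3] c4[of 4] c4[of 6] cop2 cp
      coprime_mult_right_iff[of l 2 3] coprime_mult_right_iff[of l 2 5] coprime_mult_right_iff[of l 4 3]
      coprime_mult_right_iff[of l 2 7] coprime_mult_right_iff[of l 6 3] coprime_mult_right_iff[of l 2 13]
      coprime_mult_right_iff[of l 12 3] coprime_mult_right_iff[of l 6 13]
    by simp_all
  have p2: "n + 1 < 4 \<Longrightarrow> ?thesis" using n l(2) by (intro prime[of 2]) simp_all
  have p3: "3 \<le> n + 1 \<Longrightarrow> n + 1 < 6 \<Longrightarrow> \<not> 3 dvd l \<Longrightarrow> ?thesis"
    using cop2 by (intro prime[of 3]) simp_all
  have p5: "5 \<le> n + 1 \<Longrightarrow> n + 1 < 10 \<Longrightarrow> \<not> 5 dvd l \<Longrightarrow> ?thesis"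
    using h by (intro prime[of 5]) simp_all
  have p7: "7 \<le> n + 1 \<Longrightarrow> n + 1 < 14 \<Longrightarrow> \<not> 3 dvd l \<Longrightarrow> \<not> 7 dvd l \<Longrightarrow> ?thesis"
    using h by (intro prime[of 7]) simp_all
  have p11: "11 \<le> n + 1 \<Longrightarrow> n + 1 < 22 \<Longrightarrow> \<not> 5 dvd l \<Longrightarrow> \<not> 11 dvd l \<Longrightarrow> ?thesis"
    using h by (intro prime[of 11]) simp_all
  have p13: "13 \<le> n + 1 \<Longrightarrow> n + 1 < 26 \<Longrightarrow> \<not> 3 dvd l \<Longrightarrow> \<not> 13 dvd l \<Longrightarrow> ?thesis"
    using h by (intro prime[of 13]) simp_all
  have p17: "17 \<le> n + 1 \<Longrightarrow> n + 1 < 34 \<Longrightarrow> \<not> 17 dvd l \<Longrightarrow> ?thesis"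
    using h by (intro prime[of 17]) simp_all
  have p19: "19 \<le> n + 1 \<Longrightarrow> n + 1 < 38 \<Longrightarrow> \<not> 3 dvd l \<Longrightarrow> \<not> 19 dvd l \<Longrightarrow> ?thesis"
    using h by (intro prime[of 19]) simp_all

  have d21: "21 dvd l" if "3 dvd l" "7 dvd l"
    using divides_mult[OF that] by (simp add: primes_coprime)
  have w7: ?thesis if "n = 3" "3 dvd l" "\<not> 7 dvd l"
    by (rule not_powerful_Omega_cert[of 7 3 3 2 2, OF _ _ pr(3)], code_simp) (use that in \<open>simp_all add: l(2) h cop2 d21\<close>)
  \<comment> \<open>\<open>3 ^ 7 + 1 = 4 * 547\<close> and \<open>546 = 21 * 26\<close>. Putting
    both 3 and 7 into \<open>g\<close> leaves only 13 and 547 as obstacles, and either would be a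
    third prime factor of \<open>l\<close>.\<close>
  have w547: ?thesis if "n = 3" "3 dvd l" "7 dvd l" "\<not> 13 dvd l" "\<not> 547 dvd l"
    by (rule not_powerful_Omega_cert[of 547 3 21 2 26, OF _ _ pr(13)], code_simp) (use that in \<open>simp_all add: l(2) h cop2 d21\<close>)
  have w547': ?thesis if "n = 9" "7 dvd l" "\<not> 3 dvd l" "\<not> 13 dvd l" "\<not> 547 dvd l"
    by (rule not_powerful_Omega_cert[of 547 3 7 8 78, OF _ _ pr(13)], code_simp) (use that in \<open>simp_all add: l(2) h cop2 d21\<close>)
  \<comment> \<open>\<open>5 ^ 7 + 1 = 174 * 449\<close>, and \<open>448 = 7 * 64\<close> leaves a
    power of 2 for \<open>h\<close>, so 449 itself is the only obstacle.\<close>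
  have w449: ?thesis if "n = 9" "7 dvd l" "\<not> 449 dvd l"
    by (rule not_powerful_Omega_cert[of 449 5 7 8 64, OF _ _ pr(12)], code_simp) (use that in \<open>simp_all add: l(2) h cop2 d21\<close>)
  have w13: ?thesis if "4 \<le> n" "n \<le> 9" "3 dvd l" "\<not> 13 dvd l"
    by (rule not_powerful_Omega_cert[of 13 4 3 8 4, OF _ _ pr(5)], code_simp) (use that in \<open>simp_all add: l(2) h cop2 d21\<close>)
  have w11: ?thesis if "n = 5" "5 dvd l" "\<not> 11 dvd l"
    by (rule not_powerful_Omega_cert[of 11 2 5 4 2, OF _ _ pr(4)], code_simp) (use that in \<open>simp_all add: l(2) h cop2 d21\<close>)
  have w41: ?thesis if "4 \<le> n" "n \<le> 15" "5 dvd l" "\<not> 41 dvd l"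
    by (rule not_powerful_Omega_cert[of 41 4 5 14 8, OF _ _ pr(8)], code_simp) (use that in \<open>simp_all add: l(2) h cop2 d21\<close>)
  have w43: ?thesis if "7 \<le> n" "n \<le> 21" "3 dvd l" "\<not> 7 dvd l" "\<not> 43 dvd l"
    by (rule not_powerful_Omega_cert[of 43 7 3 20 14, OF _ _ pr(9)], code_simp) (use that in \<open>simp_all add: l(2) h cop2 d21\<close>)
  have w397: ?thesis if "4 \<le> n" "n \<le> 11" "11 dvd l" "\<not> 3 dvd l" "\<not> 397 dvd l"
    by (rule not_powerful_Omega_cert[of 397 4 11 10 36, OF _ _ pr(11)], code_simp) (use that in \<open>simp_all add: l(2) h cop2 d21\<close>)
  have w89: ?thesis if "11 \<le> n" "n \<le> 15" "11 dvd l" "\<not> 89 dvd l"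
    by (rule not_powerful_Omega_cert[of 89 11 11 14 8, OF _ _ pr(10)], code_simp) (use that in \<open>simp_all add: l(2) h cop2 d21\<close>)
  \<comment> \<open>In each case below, failure of all available routes forces three of the listed
    primes to divide \<open>l\<close>.\<close>
  have t: "\<not> (s dvd l \<and> t dvd l \<and> u dvd l)"
    if "prime s" "prime t" "prime u" "s \<noteq> t" "s \<noteq> u" "t \<noteq> u" for s t u
    using three that by blast
  \<comment> \<open>The split is into ranges on which the same primes and witnesses stay
    valid.\<close>
  have "n \<le> 2 \<or> n = 3 \<or> n = 4 \<or> n = 5 \<or> (6 \<le> n \<and> n \<le> 8) \<or> n = 9 \<or> (10 \<le> n \<and> n \<le> 11) \<or> n = 12
      \<or> (13 \<le> n \<and> n \<le> 15) \<or> (16 \<le> n \<and> n \<le> 20) \<or> n = 21"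
    using n by linarith
  then consider "n \<le> 2" | "n = 3" | "n = 4" | "n = 5" | "6 \<le> n" "n \<le> 8" | "n = 9" | "10 \<le> n" "n \<le> 11"
    | "n = 12" | "13 \<le> n" "n \<le> 15" | "16 \<le> n" "n \<le> 20" | "n = 21" by blast
  thus ?thesis
  proof cases
    case 1
    thus ?thesis using p2 by simp
  next
    case 2
    have r1: ?thesis if "\<not> 3 dvd l"
      by (rule p3) (use that 2 in simp_all)
    have r2: ?thesis if "3 dvd l" "\<not> 7 dvd l"
      by (rule w7) (use that 2 in simp_all)
    have r3: ?thesis if "3 dvd l" "7 dvd l" "\<not> 13 dvd l" "\<not> 547 dvd l"
      by (rule w547) (use that 2 in simp_all)
    show ?thesis
      using r1 r2 r3
        t[OF pr(1) pr(3) pr(5), simplified] t[OF pr(1) pr(3) pr(13), simplified] by blast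
  next
    case 3
    have r1: ?thesis if "\<not> 3 dvd l"
      by (rule p3) (use that 3 in simp_all)
    have r2: ?thesis if "\<not> 5 dvd l"
      by (rule p5) (use that 3 in simp_all)
    have r3: ?thesis if "3 dvd l" "\<not> 13 dvd l"
      by (rule w13) (use that 3 in simp_all)
    show ?thesis
      using r1 r2 r3
        t[OF pr(1) pr(2) pr(5), simplified] by blast
  next
    case 4
    have r1: ?thesis if "\<not> 5 dvd l"
      by (rule p5) (use that 4 in simp_all)
    have r2: ?thesis if "5 dvd l" "\<not> 11 dvd l"
      by (rule w11) (use that 4 in simp_all)
    have r3: ?thesis if "5 dvd l" "\<not> 41 dvd l"
      by (rule w41) (use that 4 in simp_all)
    show ?thesis
      using r1 r2 r3
        t[OF pr(2) pr(4) pr(8), simplified] by blast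
  next
    case 5
    have r1: ?thesis if "\<not> 5 dvd l"
      by (rule p5) (use that 5 in simp_all)
    have r2: ?thesis if "\<not> 3 dvd l" "\<not> 7 dvd l"
      by (rule p7) (use that 5 in simp_all)
    have r3: ?thesis if "5 dvd l" "\<not> 41 dvd l"
      by (rule w41) (use that 5 in simp_all)
    show ?thesis
      using r1 r2 r3
        t[OF pr(2) pr(1) pr(8), simplified] t[OF pr(2) pr(3) pr(8), simplified] by blast
  next
    case 6
    have r1: ?thesis if "\<not> 3 dvd l" "\<not> 7 dvd l"
      by (rule p7) (use that 6 in simp_all)
    have r2: ?thesis if "3 dvd l" "\<not> 13 dvd l"
      by (rule w13) (use that 6 in simp_all)
    have r3: ?thesis if "3 dvd l" "\<not> 7 dvd l" "\<not> 43 dvd l"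
      by (rule w43) (use that 6 in simp_all)
    have r4: ?thesis if "7 dvd l" "\<not> 449 dvd l"
      by (rule w449) (use that 6 in simp_all)
    have r5: ?thesis if "7 dvd l" "\<not> 3 dvd l" "\<not> 13 dvd l" "\<not> 547 dvd l"
      by (rule w547') (use that 6 in simp_all)
    show ?thesis
      using r1 r2 r3 r4 r5
        t[OF pr(1) pr(3) pr(5), simplified] t[OF pr(1) pr(5) pr(9), simplified]
        t[OF pr(3) pr(12) pr(13), simplified] t[OF pr(3) pr(12) pr(1), simplified]
        t[OF pr(3) pr(12) pr(5), simplified] by blast
  next
    case 7
    have r1: ?thesis if "\<not> 3 dvd l" "\<not> 7 dvd l"
      by (rule p7) (use that 7 in simp_all)
    have r2: ?thesis if "\<not> 5 dvd l" "\<not> 11 dvd l"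
      by (rule p11) (use that 7 in simp_all)
    have r3: ?thesis if "5 dvd l" "\<not> 41 dvd l"
      by (rule w41) (use that 7 in simp_all)
    have r4: ?thesis if "3 dvd l" "\<not> 7 dvd l" "\<not> 43 dvd l"
      by (rule w43) (use that 7 in simp_all)
    have r5: ?thesis if "11 dvd l" "\<not> 3 dvd l" "\<not> 397 dvd l"
      by (rule w397) (use that 7 in simp_all)
    show ?thesis
      using r1 r2 r3 r4 r5
        t[OF pr(1) pr(2) pr(8), simplified] t[OF pr(3) pr(2) pr(8), simplified]
        t[OF pr(1) pr(4) pr(3), simplified] t[OF pr(1) pr(4) pr(9), simplified]
        t[OF pr(3) pr(4) pr(1), simplified] t[OF pr(3) pr(4) pr(11), simplified] by blast
  next
    case 8
    have r1: ?thesis if "\<not> 3 dvd l" "\<not> 7 dvd l"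
      by (rule p7) (use that 8 in simp_all)
    have r2: ?thesis if "\<not> 5 dvd l" "\<not> 11 dvd l"
      by (rule p11) (use that 8 in simp_all)
    have r3: ?thesis if "\<not> 3 dvd l" "\<not> 13 dvd l"
      by (rule p13) (use that 8 in simp_all)
    have r4: ?thesis if "5 dvd l" "\<not> 41 dvd l"
      by (rule w41) (use that 8 in simp_all)
    have r5: ?thesis if "3 dvd l" "\<not> 7 dvd l" "\<not> 43 dvd l"
      by (rule w43) (use that 8 in simp_all)
    show ?thesis
      using r1 r2 r3 r4 r5
        t[OF pr(1) pr(2) pr(8), simplified] t[OF pr(1) pr(4) pr(3), simplified]
        t[OF pr(1) pr(4) pr(9), simplified] t[OF pr(3) pr(2) pr(8), simplified]
        t[OF pr(3) pr(4) pr(5), simplified] t[OF pr(3) pr(2) pr(5), simplified] by blast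
  next
    case 9
    have r1: ?thesis if "\<not> 5 dvd l" "\<not> 11 dvd l"
      by (rule p11) (use that 9 in simp_all)
    have r2: ?thesis if "\<not> 3 dvd l" "\<not> 13 dvd l"
      by (rule p13) (use that 9 in simp_all)
    have r3: ?thesis if "5 dvd l" "\<not> 41 dvd l"
      by (rule w41) (use that 9 in simp_all)
    have r4: ?thesis if "3 dvd l" "\<not> 7 dvd l" "\<not> 43 dvd l"
      by (rule w43) (use that 9 in simp_all)
    have r5: ?thesis if "11 dvd l" "\<not> 89 dvd l"
      by (rule w89) (use that 9 in simp_all)
    show ?thesis
      using r1 r2 r3 r4 r5
        t[OF pr(1) pr(2) pr(8), simplified] t[OF pr(2) pr(5) pr(8), simplified]
        t[OF pr(1) pr(4) pr(3), simplified] t[OF pr(1) pr(4) pr(9), simplified]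
        t[OF pr(4) pr(5) pr(10), simplified] by blast
  next
    case 10
    have r1: ?thesis if "\<not> 5 dvd l" "\<not> 11 dvd l"
      by (rule p11) (use that 10 in simp_all)
    have r2: ?thesis if "\<not> 3 dvd l" "\<not> 13 dvd l"
      by (rule p13) (use that 10 in simp_all)
    have r3: ?thesis if "\<not> 17 dvd l"
      by (rule p17) (use that 10 in simp_all)
    show ?thesis
      using r1 r2 r3
        t[OF pr(6) pr(2) pr(1), simplified] t[OF pr(6) pr(2) pr(5), simplified]
        t[OF pr(6) pr(4) pr(1), simplified] t[OF pr(6) pr(4) pr(5), simplified] by blast
  next
    case 11
    have r1: ?thesis if "\<not> 3 dvd l" "\<not> 13 dvd l"
      by (rule p13) (use that 11 in simp_all)
    have r2: ?thesis if "\<not> 17 dvd l"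
      by (rule p17) (use that 11 in simp_all)
    have r3: ?thesis if "\<not> 3 dvd l" "\<not> 19 dvd l"
      by (rule p19) (use that 11 in simp_all)
    have r4: ?thesis if "3 dvd l" "\<not> 7 dvd l" "\<not> 43 dvd l"
      by (rule w43) (use that 11 in simp_all)
    show ?thesis
      using r1 r2 r3 r4
        t[OF pr(1) pr(6) pr(9), simplified] t[OF pr(1) pr(6) pr(3), simplified]
        t[OF pr(5) pr(6) pr(1), simplified] t[OF pr(5) pr(6) pr(7), simplified] by blast
  qed
qed

section \<open>A Chebyshev-type identity modulo 3\<close>

abbreviation vM :: "nat \<Rightarrow> real" where "vM \<equiv> mangoldt"

section \<open>Logarithmic sums expanded over the von Mangoldt function\<close>

lemma sum_ln_eq_sum_mangoldt:
  fixes f :: "nat \<Rightarrow> real"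
  assumes "I \<subseteq> {1..v}"
  shows "(\<Sum>n\<in>I. f n * ln (real n)) = (\<Sum>d=1..v. vM d * (\<Sum>n | n \<in> I \<and> d dvd n. f n))"
proof -
  have fin: "finite I" using assms finite_subset by blast
  have "(\<Sum>n\<in>I. f n * ln (real n)) = (\<Sum>n\<in>I. \<Sum>d=1..v. if d dvd n then f n * vM d else 0)"
  proof (intro sum.cong refl)
    fix n assume n: "n \<in> I"
    hence n0: "n > 0" "n \<le> v" using assms by auto
    have "f n * ln (real n) = (\<Sum>d | d dvd n. f n * vM d)"
      using mangoldt_sum[of n, where ?'a = real] n0 by (simp flip: sum_distrib_left)
    also have "{d. d dvd n} = {d \<in> {1..v}. d dvd n}"
    proof -
      have "1 \<le> d \<and> d \<le> v" if "d dvd n" for d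
        using that n0 dvd_imp_le[of d n] by (cases "d = 0") auto
      thus ?thesis by auto
    qed
    also have "(\<Sum>d\<in>\<dots>. f n * vM d) = (\<Sum>d=1..v. if d dvd n then f n * vM d else 0)"
      by (rule sum.inter_filter) simp
    finally show "f n * ln (real n) = \<dots>" .
  qed
  also have "\<dots> = (\<Sum>d=1..v. \<Sum>n\<in>I. if d dvd n then f n * vM d else 0)" by (rule sum.swap)
  also have "\<dots> = (\<Sum>d=1..v. vM d * (\<Sum>n | n \<in> I \<and> d dvd n. f n))"
    using fin by (intro sum.cong refl) (auto simp: sum_distrib_left sum.inter_filter intro!: sum.cong)
  finally show ?thesis .
qed

lemma sum_multiples:
  fixes f :: "nat \<Rightarrow> real"
  assumes "d > 0"
  shows "(\<Sum>n | n \<in> {1..m} \<and> d dvd n. f n) = (\<Sum>b=1..m div d. f (d * b))"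
proof -
  have "{n. n \<in> {1..m} \<and> d dvd n} = (\<lambda>b. d * b) ` {1..m div d}"
  proof (rule subset_antisym; rule subsetI)
    fix n assume n: "n \<in> {n. n \<in> {1..m} \<and> d dvd n}"
    then obtain b where b: "n = d * b" by auto
    moreover have "1 \<le> b" using n b by (cases b) auto
    moreover have "b \<le> m div d" using n b assms by (simp add: less_eq_div_iff_mult_less_eq mult.commute)
    ultimately show "n \<in> (\<lambda>b. d * b) ` {1..m div d}" by auto
  qed (use assms in \<open>auto simp: less_eq_div_iff_mult_less_eq mult.commute\<close>)
  moreover have "inj_on (\<lambda>b. d * b) {1..m div d}" using assms by (auto simp: inj_on_def)
  ultimately show ?thesis by (simp add: sum.reindex)
qed

definition sum_ln :: "nat \<Rightarrow> real" where
  "sum_ln m = (\<Sum>n=1..m. ln (real n))"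

text \<open>The added terms have \<open>m div d div i = 0\<close>. Giving all expansions the common
  range \<open>d \<le> m\<close> allows them to be combined coefficient by coefficient.\<close>

lemma sum_extend_div:
  fixes m i :: nat
  assumes "i > 0" "\<And>d. g d 0 = (0::real)"
  shows "(\<Sum>d=1..m div i. g d (m div i div d)) = (\<Sum>d=1..m. g d (m div d div i))"
proof -
  have comm: "m div i div d = m div d div i" for d
    using div_mult2_eq[of m i d] div_mult2_eq[of m d i] by (simp add: mult.commute)
  hence "(\<Sum>d=1..m div i. g d (m div i div d)) = (\<Sum>d=1..m div i. g d (m div d div i))" by simp
  also have "\<dots> = (\<Sum>d=1..m. g d (m div d div i))"
  proof (rule sum.mono_neutral_left)
    show "\<forall>d\<in>{1..m} - {1..m div i}. g d (m div d div i) = 0"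
    proof
      fix d assume d: "d \<in> {1..m} - {1..m div i}"
      hence "m div i div d = 0" by auto
      hence "m div d div i = 0" by (simp only: comm)
      thus "g d (m div d div i) = 0" using assms by simp
    qed
  qed (auto intro: order.trans[OF _ div_le_dividend])
  finally show ?thesis .
qed

lemma sum_ln_mangoldt: "sum_ln m = (\<Sum>d=1..m. vM d * real (m div d))"
proof -
  have "sum_ln m = (\<Sum>d=1..m. vM d * (\<Sum>n | n \<in> {1..m} \<and> d dvd n. 1))"
    unfolding sum_ln_def using sum_ln_eq_sum_mangoldt[of "{1..m}" m "\<lambda>_. 1"] by simp
  also have "\<dots> = (\<Sum>d=1..m. vM d * real (m div d))"
    by (intro sum.cong refl) (subst sum_multiples, auto)
  finally show ?thesis .
qed

lemma sum_ln_div: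
  assumes "i > 0"
  shows "sum_ln (m div i) = (\<Sum>d=1..m. vM d * real (m div d div i))"
  unfolding sum_ln_mangoldt using assms
  by (rule sum_extend_div[where g = "\<lambda>d y. vM d * real y"]) simp

section \<open>The character modulo 3\<close>

definition chi3 :: "nat \<Rightarrow> real" where
  "chi3 n = (if n mod 3 = 1 then 1 else if n mod 3 = 2 then - 1 else 0)"

definition sum_chi3_ln :: "nat \<Rightarrow> real" where
  "sum_chi3_ln m = (\<Sum>n=1..m. chi3 n * ln (real n))"

lemma chi3_mult: "chi3 (a * b) = chi3 a * chi3 b"
proof -
  have "a mod 3 = 0 \<or> a mod 3 = 1 \<or> a mod 3 = 2" "b mod 3 = 0 \<or> b mod 3 = 1 \<or> b mod 3 = 2"
    by presburger+
  moreover have "a * b mod 3 = (a mod 3) * (b mod 3) mod 3" by (simp add: mod_mult_eq)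
  ultimately show ?thesis by (elim disjE) (simp_all add: chi3_def)
qed

lemma sum_chi3: "(\<Sum>b=1..y. chi3 b) = (if y mod 3 = 1 then 1 else 0)"
  by (induction y) (auto simp: chi3_def mod_Suc)

lemma sum_chi3_ln_mangoldt:
  "sum_chi3_ln m = (\<Sum>d=1..m. vM d * (chi3 d * (if m div d mod 3 = 1 then 1 else 0)))"
proof -
  have "sum_chi3_ln m = (\<Sum>d=1..m. vM d * (\<Sum>n | n \<in> {1..m} \<and> d dvd n. chi3 n))"
    unfolding sum_chi3_ln_def using sum_ln_eq_sum_mangoldt[of "{1..m}" m chi3] by simp
  also have "\<dots> = (\<Sum>d=1..m. vM d * (chi3 d * (if m div d mod 3 = 1 then 1 else 0)))"
  proof (intro sum.cong refl)
    fix d assume "d \<in> {1..m}"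
    hence "(\<Sum>n | n \<in> {1..m} \<and> d dvd n. chi3 n) = chi3 d * (\<Sum>b=1..m div d. chi3 b)"
      by (subst sum_multiples) (simp_all add: chi3_mult sum_distrib_left)
    thus "vM d * (\<Sum>n | n \<in> {1..m} \<and> d dvd n. chi3 n) =
        vM d * (chi3 d * (if m div d mod 3 = 1 then 1 else 0))"
      by (simp only: sum_chi3)
  qed
  finally show ?thesis .
qed

lemma sum_chi3_ln_div:
  assumes "i > 0"
  shows "sum_chi3_ln (m div i) =
    (\<Sum>d=1..m. vM d * (chi3 d * (if m div d div i mod 3 = 1 then 1 else 0)))"
  unfolding sum_chi3_ln_mangoldt using assms
  by (rule sum_extend_div[where g = "\<lambda>d y. vM d * (chi3 d * (if y mod 3 = 1 then 1 else 0))"]) simp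

text \<open>The nonzero terms alternate in sign and grow in size, so a partial sum lies between 0
  and its last term, with a sign determined by \<open>m mod 3\<close>. Thus the classes 1 and 2
  modulo 3 are told apart at only logarithmic cost.\<close>

lemma abs_sum_chi3_ln_le: "\<bar>sum_chi3_ln m\<bar> \<le> ln (real m)"
proof -
  have "if m mod 3 = 1 then 0 \<le> sum_chi3_ln m \<and> sum_chi3_ln m \<le> ln (real m)
    else - ln (real m) \<le> sum_chi3_ln m \<and> sum_chi3_ln m \<le> 0"
  proof (induction m)
    case 0
    thus ?case by (simp add: sum_chi3_ln_def)
  next
    case (Suc m)
    have step: "sum_chi3_ln (Suc m) = sum_chi3_ln m + chi3 (Suc m) * ln (real (Suc m))"
      by (simp add: sum_chi3_ln_def)
    define L where "L = ln (real m)"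
    define L' where "L' = ln (real (Suc m))"
    have mono: "L \<le> L'" "0 \<le> L'" unfolding L_def L'_def by (cases "m = 0"; simp)+
    have "m mod 3 = 0 \<or> m mod 3 = 1 \<or> m mod 3 = 2" by presburger
    thus ?case using Suc mono unfolding step L_def[symmetric] L'_def[symmetric]
      by (elim disjE) (simp_all add: chi3_def mod_Suc del: of_nat_Suc)
  qed
  moreover have "0 \<le> ln (real m)" by (cases "m = 0") auto
  ultimately show ?thesis by (auto split: if_splits)
qed

section \<open>Stirling-type estimates\<close>

lemma sum_ln_bounds:
  assumes "n \<ge> 1"
  shows "real n * ln n - n + 1 \<le> sum_ln n" "sum_ln n \<le> real n * ln n - n + 1 + ln n"
proof -
  have "real n * ln n - n + 1 \<le> sum_ln n \<and> sum_ln n \<le> real n * ln n - n + 1 + ln n"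
    using assms
  proof (induction n rule: dec_induct)
    case base
    thus ?case by (simp add: sum_ln_def)
  next
    case (step n)
    have n: "real n > 0" using step by simp
    have st: "sum_ln (Suc n) = sum_ln n + ln (real (Suc n))" by (simp add: sum_ln_def)
    have "ln (real (Suc n) / real n) \<le> real (Suc n) / real n - 1" using n by (intro ln_le_minus_one) auto
    also have "\<dots> = 1 / real n" using n by (simp add: field_simps)
    finally have u: "real n * (ln (real (Suc n)) - ln (real n)) \<le> 1"
      using n by (simp add: ln_div field_simps)
    have "ln (real n / real (Suc n)) \<le> real n / real (Suc n) - 1" using n by (intro ln_le_minus_one) auto
    also have "\<dots> = - (1 / real (Suc n))" by (simp add: field_simps)
    finally have "real (Suc n) * (ln (real n) - ln (real (Suc n))) \<le> - 1"
      using n by (simp add: ln_div field_simps)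
    hence l: "1 \<le> real (Suc n) * (ln (real (Suc n)) - ln (real n))" by (simp add: algebra_simps)
    show ?case unfolding st using step.IH u l by (simp add: algebra_simps)
  qed
  thus "real n * ln n - n + 1 \<le> sum_ln n" "sum_ln n \<le> real n * ln n - n + 1 + ln n" by auto
qed

lemma sum_ln_ge: "real n * ln n - n \<le> sum_ln n"
  using sum_ln_bounds(1)[of n] by (cases "n = 0") (auto simp: sum_ln_def)

text \<open>The function \<open>x * ln x - x\<close> has derivative \<open>ln x\<close>, so rounding
  \<open>m / i\<close> down to an integer costs no more than a logarithm.\<close>

lemma sum_ln_div_approx:
  assumes "i > 0" "i \<le> m"
  shows "\<bar>sum_ln (m div i) - (m / i) * (ln m - ln i - 1)\<bar> \<le> ln m + 1"
proof -
  define n where "n = m div i"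
  define x where "x = real m / real i"
  have n1: "n \<ge> 1" unfolding n_def using assms by (simp add: Suc_le_eq div_greater_zero_iff)
  have "real n \<le> x" 
  proof -
    have "n * i \<le> m" unfolding n_def by simp
    hence "real (n * i) \<le> real m" by (simp only: of_nat_le_iff)
    thus ?thesis unfolding x_def using assms by (simp add: field_simps)
  qed
  moreover have "x < real n + 1"
  proof -
    have "m < (n + 1) * i" unfolding n_def using assms
      by (metis add.commute dividend_less_times_div mult.commute mult_Suc_right plus_1_eq_Suc)
    hence "real m < real ((n + 1) * i)" by (simp only: of_nat_less_iff)
    thus ?thesis unfolding x_def using assms by (simp add: field_simps)
  qed
  ultimately have x: "real n \<le> x" "x < real n + 1" by auto
  have npos: "real n > 0" using n1 by simp
  have lnx: "ln x = ln m - ln i" unfolding x_def using assms by (simp add: ln_div)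
  have lnxm: "ln x \<le> ln m" unfolding lnx using assms by simp
  have "ln (real n / x) \<le> real n / x - 1" using npos x by (intro ln_le_minus_one) auto
  hence a: "x * (ln n - ln x) \<le> real n - x" using npos x by (simp add: ln_div field_simps)
  have "ln (x / real n) \<le> x / real n - 1" using npos x by (intro ln_le_minus_one) auto
  hence b: "real n * (ln x - ln n) \<le> x - real n" using npos x by (simp add: ln_div field_simps)
  have lnn: "ln n \<le> ln x" "0 \<le> ln (real n)" using npos x n1 by auto
  have c: "(x - real n) * ln n \<ge> 0" "(x - real n) * ln x \<le> 1 * ln x"
    using x lnn by (simp, intro mult_right_mono) linarith+
  have "sum_ln n \<le> real n * ln n - n + 1 + ln n" using sum_ln_bounds(2)[OF n1] .
  also have "\<dots> \<le> x * ln x - x + 1 + ln x"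
    using a b c lnn by (simp add: algebra_simps)
  finally have up: "sum_ln n \<le> x * (ln x - 1) + 1 + ln m" using lnxm by (simp add: algebra_simps)
  have "x * (ln x - 1) - ln m \<le> x * ln x - x - ln x" using lnxm by (simp add: algebra_simps)
  also have "\<dots> \<le> real n * ln n - n + 1" using a b c lnn x by (simp add: algebra_simps)
  also have "\<dots> \<le> sum_ln n" using sum_ln_bounds(1)[OF n1] .
  finally have lo: "x * (ln x - 1) - ln m \<le> sum_ln n" .
  show ?thesis using up lo unfolding lnx n_def[symmetric] x_def[symmetric] by (simp add: abs_le_iff algebra_simps)
qed

text \<open>
  The combination was found by linear programming. With \<open>y = m div d\<close> its value is 2 for the
  \<open>d\<close> in \<open>(m / 2, m]\<close> congruent to 2 modulo 3; it is positive at other \<open>d\<close> prime to 3 only if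
  \<open>d \<le> m / 5\<close>.
\<close>

definition cheb_weight :: "nat \<Rightarrow> nat \<Rightarrow> real" where
  "cheb_weight d y = real y - 2 * real (y div 2) - real (y div 3) + real (y div 4) + real (y div 12)
     - chi3 d * ((if y mod 3 = 1 then 1 else 0) - (if y div 4 mod 3 = 1 then 1 else 0))"

text \<open>Since \<open>1 - 2/2 - 1/3 + 1/4 + 1/12 = 0\<close>, the linear growth in
  \<open>y\<close> cancels and the weight depends on \<open>y\<close> only modulo 12. What remains
  is a check of twelve residues against three classes of \<open>d\<close>.\<close>

lemma cheb_weight_le:
  "cheb_weight d y \<le>
     (if d mod 3 = 0 then 1
      else if d mod 3 = 2 \<and> y mod 12 = 1 \<or> d mod 3 = 1 \<and> y mod 12 = 5 then 2 else 0)"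
proof -
  define k where "k = y div 12"
  define r where "r = y mod 12"
  have y: "y = 12 * k + r" by (simp add: k_def r_def)
  have "r < 12" by (simp add: r_def)
  hence "r = 0 \<or> r = 1 \<or> r = 2 \<or> r = 3 \<or> r = 4 \<or> r = 5 \<or> r = 6 \<or> r = 7 \<or> r = 8 \<or> r = 9 \<or> r = 10 \<or> r = 11"
    by presburger
  moreover have "cheb_weight d y =
      real r - 2 * real (r div 2) - real (r div 3) + real (r div 4)
       - chi3 d * ((if r mod 3 = 1 then 1 else 0) - (if r div 4 mod 3 = 1 then 1 else 0))"
  proof -
    have y2: "y = r + 2 * (6 * k)" and y3: "y = r + 3 * (4 * k)" and y4: "y = r + 4 * (3 * k)"
      using y by simp_all
    have d2: "y div 2 = 6 * k + r div 2" unfolding y2 by (subst div_mult_self2) simp_all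
    have d3: "y div 3 = 4 * k + r div 3" unfolding y3 by (subst div_mult_self2) simp_all
    have d4: "y div 4 = 3 * k + r div 4" unfolding y4 by (subst div_mult_self2) simp_all
    have m3: "y mod 3 = r mod 3" unfolding y3 by (rule mod_mult_self2)
    have m4: "(3 * k + r div 4) mod 3 = r div 4 mod 3" by simp
    have d12: "y div 12 = k" by (simp add: k_def)
    have "real y - 2 * real (y div 2) - real (y div 3) + real (y div 4) + real (y div 12)
        = real r - 2 * real (r div 2) - real (r div 3) + real (r div 4)"
      unfolding d2 d3 d4 d12 by (subst y) simp
    thus ?thesis unfolding cheb_weight_def d4 m3 m4 by simp
  qed
  moreover have "d mod 3 = 0 \<or> d mod 3 = 1 \<or> d mod 3 = 2" by presburger
  moreover have "y mod 12 = r" by (simp add: r_def)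
  ultimately show ?thesis by (elim disjE) (simp_all add: chi3_def)
qed

lemma sum_cheb_weight:
  "(\<Sum>d=1..m. vM d * cheb_weight d (m div d)) =
     sum_ln m - 2 * sum_ln (m div 2) - sum_ln (m div 3) + sum_ln (m div 4) + sum_ln (m div 12)
     - sum_chi3_ln m + sum_chi3_ln (m div 4)"
proof -
  have "sum_ln m - 2 * sum_ln (m div 2) - sum_ln (m div 3) + sum_ln (m div 4) + sum_ln (m div 12)
     - sum_chi3_ln m + sum_chi3_ln (m div 4) =
     (\<Sum>d=1..m. vM d * real (m div d)) - 2 * (\<Sum>d=1..m. vM d * real (m div d div 2))
     - (\<Sum>d=1..m. vM d * real (m div d div 3)) + (\<Sum>d=1..m. vM d * real (m div d div 4))
     + (\<Sum>d=1..m. vM d * real (m div d div 12))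
     - (\<Sum>d=1..m. vM d * (chi3 d * (if m div d mod 3 = 1 then 1 else 0)))
     + (\<Sum>d=1..m. vM d * (chi3 d * (if m div d div 4 mod 3 = 1 then 1 else 0)))"
    by (simp only: sum_ln_div[of 2] sum_ln_div[of 3] sum_ln_div[of 4] sum_ln_div[of 12]
        sum_ln_mangoldt[of m] sum_chi3_ln_mangoldt[of m] sum_chi3_ln_div[of 4] zero_less_numeral)
  also have "\<dots> = (\<Sum>d=1..m. vM d * cheb_weight d (m div d))"
    unfolding sum_distrib_left sum_subtractf[symmetric] sum.distrib[symmetric]
    by (intro sum.cong refl) (simp only: cheb_weight_def algebra_simps)
  finally show ?thesis by simp
qed

text \<open>The same relation cancels the terms of order \<open>m * ln m\<close> and those linear in
  \<open>m\<close> without a \<open>ln i\<close>. The errors are \<open>ln m + 1\<close> six times,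
  counting the coefficient 2 twice, and \<open>ln m\<close> for each of the two character
  sums.\<close>

lemma sum_cheb_weight_ge:
  assumes m: "m \<ge> 12"
  shows "(\<Sum>d=1..m. vM d * cheb_weight d (m div d)) \<ge> m * (ln 2 / 3 + ln 3 / 4) - 8 * ln m - 6"
proof -
  have pos: "real m > 0" using m by simp
  have ln4: "ln (4::real) = 2 * ln 2" using ln_realpow[of 2 2] by simp
  have ln12: "ln (12::real) = 2 * ln 2 + ln 3" using ln_mult[of 4 3] ln4 by simp
  have T: "\<bar>sum_ln (m div i) - (m / i) * (ln m - ln i - 1)\<bar> \<le> ln m + 1" if "i > 0" "i \<le> 12" for i
    using sum_ln_div_approx[of i m] that m by simp
  have "\<bar>sum_chi3_ln (m div 4)\<bar> \<le> ln (real (m div 4))" by (rule abs_sum_chi3_ln_le)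
  also have "\<dots> \<le> ln (real m)"
  proof -
    have "m div 4 > 0" using m by (simp add: div_greater_zero_iff)
    thus ?thesis by simp
  qed
  finally have X4: "\<bar>sum_chi3_ln (m div 4)\<bar> \<le> ln (real m)" .
  have "m * (ln 2 / 3 + ln 3 / 4) = (m / 1) * (ln m - ln 1 - 1) - 2 * ((m / 2) * (ln m - ln 2 - 1))
     - (m / 3) * (ln m - ln 3 - 1) + (m / 4) * (ln m - ln 4 - 1) + (m / 12) * (ln m - ln 12 - 1)"
    by (simp add: ln4 ln12 field_simps)
  thus ?thesis
    unfolding sum_cheb_weight
    using T[of 1] T[of 2] T[of 3] T[of 4] T[of 12] X4 abs_sum_chi3_ln_le[of m] by (simp add: abs_le_iff)
qed

section \<open>Von Mangoldt sums over the multiples of a prime\<close>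

lemma exponent_le:
  fixes p k N :: nat
  assumes "p > 1" "p ^ k \<le> N"
  shows "k \<le> N"
  using power_gt_expt[of p k] assms by linarith

lemma sum_mangoldt_dvd_eq:
  fixes p N :: nat
  assumes p: "prime p"
  shows "(\<Sum>d | d \<in> {1..N} \<and> p dvd d. vM d * g d) = (\<Sum>k | 1 \<le> k \<and> p ^ k \<le> N. ln p * g (p ^ k))"
proof -
  have p1: "p > 1" using p prime_gt_1_nat by blast
  have fin: "finite {k. 1 \<le> k \<and> p ^ k \<le> N}"
  proof (rule finite_subset)
    show "{k. 1 \<le> k \<and> p ^ k \<le> N} \<subseteq> {..N}"
      using exponent_le[OF p1] by auto
  qed simp
  have "(\<Sum>d | d \<in> {1..N} \<and> p dvd d. vM d * g d) = (\<Sum>d\<in>(\<lambda>k. p ^ k) ` {k. 1 \<le> k \<and> p ^ k \<le> N}. vM d * g d)"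
  proof (rule sum.mono_neutral_right)
    show "(\<lambda>k. p ^ k) ` {k. 1 \<le> k \<and> p ^ k \<le> N} \<subseteq> {d. d \<in> {1..N} \<and> p dvd d}"
      using p1 by (auto simp: Suc_le_eq intro!: dvd_power)
    show "\<forall>d\<in>{d. d \<in> {1..N} \<and> p dvd d} - (\<lambda>k. p ^ k) ` {k. 1 \<le> k \<and> p ^ k \<le> N}. vM d * g d = 0"
    proof
      fix d assume d: "d \<in> {d. d \<in> {1..N} \<and> p dvd d} - (\<lambda>k. p ^ k) ` {k. 1 \<le> k \<and> p ^ k \<le> N}"
      have "\<not> primepow d"
      proof
        assume "primepow d"
        then obtain q k where qk: "prime q" "k > 0" "d = q ^ k" unfolding primepow_def by auto
        hence "p dvd q" using d p prime_dvd_power by auto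
        hence "p = q" using p qk(1) by (simp add: primes_dvd_imp_eq)
        thus False using d qk by auto
      qed
      thus "vM d * g d = 0" by (simp add: mangoldt_def)
    qed
  qed simp
  also have "\<dots> = (\<Sum>k | 1 \<le> k \<and> p ^ k \<le> N. vM (p ^ k) * g (p ^ k))"
    using p1 by (subst sum.reindex) (auto simp: inj_on_def)
  also have "\<dots> = (\<Sum>k | 1 \<le> k \<and> p ^ k \<le> N. ln p * g (p ^ k))"
    using p by (intro sum.cong refl) (auto simp: mangoldt_primepow)
  finally show ?thesis .
qed

text \<open>Only the powers of \<open>p\<close> count, each with weight \<open>ln p\<close>, and
  there are at most \<open>ln N / ln p\<close> of them.\<close>

lemma sum_mangoldt_multiples_le:
  fixes p N :: nat
  assumes p: "prime p" and N: "N > 0"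
  shows "(\<Sum>d | d \<in> {1..N} \<and> p dvd d. vM d) \<le> ln N"
proof -
  have p1: "p > 1" using p prime_gt_1_nat by blast
  hence lnp: "ln (real p) > 0" by simp
  have sub: "{k. 1 \<le> k \<and> p ^ k \<le> N} \<subseteq> {1..nat \<lfloor>ln N / ln p\<rfloor>}"
  proof
    fix k assume "k \<in> {k. 1 \<le> k \<and> p ^ k \<le> N}"
    hence k: "1 \<le> k" "real (p ^ k) \<le> real N" by (auto simp del: of_nat_power)
    hence "ln (real (p ^ k)) \<le> ln N" using p1 N by (subst ln_le_cancel_iff) auto
    hence "real k * ln p \<le> ln N" using p1 by (simp add: ln_realpow)
    hence "real k \<le> ln N / ln p" using lnp by (simp add: field_simps)
    thus "k \<in> {1..nat \<lfloor>ln N / ln p\<rfloor>}" using k by (simp add: le_nat_iff le_floor_iff)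
  qed
  have "(\<Sum>d | d \<in> {1..N} \<and> p dvd d. vM d) = (\<Sum>k | 1 \<le> k \<and> p ^ k \<le> N. ln p)"
    using sum_mangoldt_dvd_eq[OF p, of "\<lambda>_. 1" N] by simp
  also have "\<dots> \<le> (\<Sum>k\<in>{1..nat \<lfloor>ln N / ln p\<rfloor>}. ln (real p))"
    using sub lnp by (intro sum_mono2) auto
  also have "\<dots> = real (nat \<lfloor>ln N / ln p\<rfloor>) * ln p" by simp
  also have "\<dots> \<le> (ln N / ln p) * ln p"
    using lnp N by (intro mult_right_mono) (auto simp: of_nat_nat)
  also have "\<dots> = ln N" using lnp by simp
  finally show ?thesis .
qed

lemma geometric_le:
  fixes x :: real
  assumes "x > 1"
  shows "(\<Sum>k=1..K. (1 / x) ^ k) \<le> 1 / (x - 1)"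
proof -
  have step: "y / x + y / (x * (x - 1)) = y / (x - 1)" for y using assms by (simp add: field_simps)
  have "(\<Sum>k=1..K. (1 / x) ^ k) + (1 / x) ^ K / (x - 1) = 1 / (x - 1)"
  proof (induction K)
    case (Suc K)
    thus ?case using step[of "(1 / x) ^ K"] by (simp add: mult.commute)
  qed simp
  moreover have "(1 / x) ^ K / (x - 1) \<ge> 0" using assms by simp
  ultimately show ?thesis by linarith
qed

text \<open>This is the contribution of \<open>p\<close> to \<open>ln (N!)\<close>: by Legendre's
  formula and a geometric series the exponent is at most \<open>N / (p - 1)\<close>.\<close>

lemma sum_mangoldt_multiples_div_le:
  fixes p N v :: nat
  assumes p: "prime p" and v: "N \<le> v"
  shows "(\<Sum>d | d \<in> {1..v} \<and> p dvd d. vM d * real (N div d)) \<le> N * (ln (real p) / (real p - 1))"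
proof -
  have p1: "p > 1" using p prime_gt_1_nat by blast
  have sub: "{k. 1 \<le> k \<and> p ^ k \<le> v} \<subseteq> {1..v}"
    using exponent_le[OF p1] by auto
  have "(\<Sum>d | d \<in> {1..v} \<and> p dvd d. vM d * real (N div d))
      = (\<Sum>k | 1 \<le> k \<and> p ^ k \<le> v. ln p * real (N div p ^ k))"
    by (rule sum_mangoldt_dvd_eq[OF p])
  also have "\<dots> \<le> (\<Sum>k=1..v. ln p * real (N div p ^ k))"
    using sub p1 by (intro sum_mono2) auto
  also have "\<dots> \<le> (\<Sum>k=1..v. ln p * (N * (1 / p) ^ k))"
  proof (intro sum_mono mult_left_mono)
    fix k
    have "real (N div p ^ k) \<le> real N / real (p ^ k)" by (rule of_nat_div_le_of_nat)
    thus "real (N div p ^ k) \<le> N * (1 / p) ^ k" by (simp add: power_divide)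
  qed (use p1 in simp)
  also have "\<dots> = N * ln p * (\<Sum>k=1..v. (1 / real p) ^ k)"
    by (simp add: sum_distrib_left mult_ac)
  also have "\<dots> \<le> N * ln p * (1 / (real p - 1))"
    using p1 by (intro mult_left_mono geometric_le) auto
  finally show ?thesis by simp
qed

section \<open>An upper bound for primes in progressions\<close>

text \<open>As \<open>Q\<close> is invertible modulo \<open>d\<close>, every block of
  \<open>d\<close> consecutive indices contains one whose term is a multiple of \<open>d\<close>,
  and there are \<open>N div d\<close> disjoint blocks.\<close>

lemma card_multiples_progression:
  fixes Q c d N k0 :: nat
  assumes cop: "coprime d Q" and d: "d > 0" and Q: "Q > 0"
  shows "N div d \<le> card {n \<in> (\<lambda>k. c + k * Q) ` {k0..<k0+N}. d dvd n}"
proof -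
  have ex: "\<exists>k\<in>{a..<a+d}. d dvd c + k * Q" for a
  proof -
    \<comment> \<open>The factor \<open>d - 1\<close> plays the role of \<open>- 1\<close> modulo
      \<open>d\<close> within the natural numbers.\<close>
    obtain x where x: "[Q * x = (d - 1) * (c + a * Q)] (mod d)"
      using cong_solve[of Q d] cop by (auto simp: coprime_commute)
    define k where "k = a + x mod d"
    have "k \<in> {a..<a+d}" using d by (simp add: k_def)
    moreover have "d dvd c + k * Q"
    proof -
      have "[c + k * Q = (c + a * Q) + Q * (x mod d)] (mod d)" by (simp add: k_def algebra_simps)
      also have "[(c + a * Q) + Q * (x mod d) = (c + a * Q) + Q * x] (mod d)"
        by (intro cong_add cong_mult) auto
      also have "[(c + a * Q) + Q * x = (c + a * Q) + (d - 1) * (c + a * Q)] (mod d)"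
        by (intro cong_add x) auto
      also have "(c + a * Q) + (d - 1) * (c + a * Q) = d * (c + a * Q)"
        using d by (cases d) auto
      finally show ?thesis by (simp add: cong_dvd_iff)
    qed
    ultimately show ?thesis by blast
  qed
  \<comment> \<open>An index from the \<open>i\<close>-th block; division by \<open>d\<close>
    recovers \<open>i\<close>, which gives injectivity.\<close>
  define f where "f i = (SOME k. k \<in> {k0 + i * d..<k0 + i * d + d} \<and> d dvd c + k * Q)" for i
  have f: "f i \<in> {k0 + i * d..<k0 + i * d + d}" "d dvd c + f i * Q" for i
  proof -
    have "\<exists>k. k \<in> {k0 + i * d..<k0 + i * d + d} \<and> d dvd c + k * Q" using ex[of "k0 + i * d"] by blast
    hence "f i \<in> {k0 + i * d..<k0 + i * d + d} \<and> d dvd c + f i * Q"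
      unfolding f_def by (rule someI_ex)
    thus "f i \<in> {k0 + i * d..<k0 + i * d + d}" "d dvd c + f i * Q" by auto
  qed
  have f_div: "(f i - k0) div d = i" for i
  proof -
    have "f i - k0 = i * d + (f i - k0 - i * d)" "f i - k0 - i * d < d" using f(1)[of i] by auto
    thus ?thesis using d by (metis add.commute div_less div_mult_self3 add_0 not_gr_zero)
  qed
  have "inj_on (\<lambda>i. c + f i * Q) {..<N div d}"
  proof (rule inj_onI)
    fix i j assume "c + f i * Q = c + f j * Q"
    hence "f i = f j" using Q by simp
    thus "i = j" using f_div by metis
  qed
  moreover have "(\<lambda>i. c + f i * Q) ` {..<N div d} \<subseteq> {n \<in> (\<lambda>k. c + k * Q) ` {k0..<k0+N}. d dvd n}"
  proof safe
    fix i assume "i < N div d"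
    hence "(i + 1) * d \<le> N" using d by (metis Suc_eq_plus1 Suc_leI less_eq_div_iff_mult_less_eq)
    hence "f i \<in> {k0..<k0+N}" using f(1)[of i] by (auto simp: algebra_simps)
    thus "c + f i * Q \<in> (\<lambda>k. c + k * Q) ` {k0..<k0+N}" by blast
  qed (use f in auto)
  ultimately have "card {..<N div d} \<le> card {n \<in> (\<lambda>k. c + k * Q) ` {k0..<k0+N}. d dvd n}"
    by (intro card_inj_on_le[where f = "\<lambda>i. c + f i * Q"]) auto
  thus ?thesis by simp
qed

text \<open>A bound, per unit of \<open>N\<close>, for the part of \<open>ln (N!)\<close> due to the
  primes dividing \<open>Q\<close>.\<close>

definition sieve_const :: "nat \<Rightarrow> real" where
  "sieve_const Q = (\<Sum>p\<in>prime_factors Q. ln (real p) / (real p - 1))"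

lemma sum_UN_le:
  fixes f :: "'b \<Rightarrow> real"
  assumes "finite A" "\<And>a. a \<in> A \<Longrightarrow> finite (B a)" "\<And>x. f x \<ge> 0"
  shows "sum f (\<Union>a\<in>A. B a) \<le> (\<Sum>a\<in>A. sum f (B a))"
  using assms
proof (induction A rule: finite_induct)
  case (insert a A)
  have "sum f (\<Union>x\<in>insert a A. B x) = sum f (B a \<union> (\<Union>x\<in>A. B x))" by simp
  also have "\<dots> \<le> sum f (B a) + sum f (\<Union>x\<in>A. B x)"
    using insert by (subst sum_Un) (auto intro: sum_nonneg)
  also have "\<dots> \<le> sum f (B a) + (\<Sum>a\<in>A. sum f (B a))" using insert by simp
  finally show ?case using insert by simp
qed simp

lemma sum_mangoldt_not_coprime_le:
  fixes g :: "nat \<Rightarrow> real"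
  assumes g: "\<And>d. g d \<ge> 0" and Q: "Q > 0"
  shows "(\<Sum>d | d \<in> {1..v} \<and> \<not> coprime d Q. vM d * g d)
    \<le> (\<Sum>p\<in>prime_factors Q. \<Sum>d | d \<in> {1..v} \<and> p dvd d. vM d * g d)"
proof -
  have "(\<Sum>d | d \<in> {1..v} \<and> \<not> coprime d Q. vM d * g d)
      \<le> (\<Sum>d\<in>(\<Union>p\<in>prime_factors Q. {d. d \<in> {1..v} \<and> p dvd d}). vM d * g d)"
  proof (rule sum_mono2)
    show "{d. d \<in> {1..v} \<and> \<not> coprime d Q} \<subseteq> (\<Union>p\<in>prime_factors Q. {d. d \<in> {1..v} \<and> p dvd d})"
    proof
      fix d assume d: "d \<in> {d. d \<in> {1..v} \<and> \<not> coprime d Q}"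
      hence "gcd d Q \<noteq> 1" using coprime_iff_gcd_eq_1 by blast
      then obtain p where p: "prime p" "p dvd gcd d Q" using prime_factor_nat by blast
      have "p dvd d" "p dvd Q" using p(2) by (meson dvd_trans gcd_dvd1 gcd_dvd2)+
      thus "d \<in> (\<Union>p\<in>prime_factors Q. {d. d \<in> {1..v} \<and> p dvd d})"
        using d p(1) Q by (auto simp: in_prime_factors_iff)
    qed
  qed (auto intro!: mult_nonneg_nonneg mangoldt_nonneg g)
  also have "\<dots> \<le> (\<Sum>p\<in>prime_factors Q. \<Sum>d | d \<in> {1..v} \<and> p dvd d. vM d * g d)"
    by (rule sum_UN_le) (auto intro!: mult_nonneg_nonneg mangoldt_nonneg g)
  finally show ?thesis .
qed

text \<open>Write \<open>\<Sum>n\<in>I. ln n\<close> as a sum of \<open>vM d\<close> times the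
  number of multiples of \<open>d\<close> in \<open>I\<close>. For \<open>d\<close> coprime to
  \<open>Q\<close> this number is at least \<open>N div d\<close>, which accounts for the part of
  \<open>N!\<close> coprime to \<open>Q\<close>. Each \<open>d \<in> I\<close> counts itself in
  addition, since \<open>d > N\<close> makes its share in \<open>N!\<close> zero.\<close>

lemma sum_mangoldt_progression_le:
  fixes Q c N k0 :: nat
  assumes Q: "Q > 0" and pos: "c + k0 * Q > 0"
  defines "I \<equiv> (\<lambda>k. c + k * Q) ` {k0..<k0+N}"
  assumes cop: "\<And>n. n \<in> I \<Longrightarrow> coprime n Q" and large: "\<And>n. n \<in> I \<Longrightarrow> n > N"
  shows "(\<Sum>d\<in>I. vM d) \<le> (\<Sum>n\<in>I. ln (real n)) - sum_ln N + N * sieve_const Q"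
proof -
  \<comment> \<open>Any common upper bound of \<open>I\<close> and \<open>N\<close> would serve as
    the range of \<open>d\<close>.\<close>
  define v where "v = c + (k0 + N) * Q + N"
  have fin: "finite I" by (simp add: I_def)
  have I: "I \<subseteq> {1..v}"
  proof
    fix n assume "n \<in> I"
    then obtain k where k: "n = c + k * Q" "k \<in> {k0..<k0+N}" unfolding I_def by blast
    hence "k0 \<le> k" "k \<le> k0 + N" by auto
    hence "k0 * Q \<le> k * Q" "k * Q \<le> (k0 + N) * Q" by (simp_all only: mult_le_mono1)
    hence "1 \<le> n" "n \<le> v" using pos k(1) unfolding v_def by linarith+
    thus "n \<in> {1..v}" by simp
  qed
  have Nv: "N \<le> v" by (simp add: v_def)
  have "(\<Sum>d\<in>I. vM d) + (\<Sum>d=1..v. vM d * (if coprime d Q then real (N div d) else 0))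
      = (\<Sum>d=1..v. vM d * ((if d \<in> I then 1 else 0) + (if coprime d Q then real (N div d) else 0)))"
  proof -
    have "(\<Sum>d\<in>I. vM d) = (\<Sum>d=1..v. if d \<in> I then vM d else 0)"
      using I by (simp add: sum.If_cases Int_absorb1)
    also have "\<dots> = (\<Sum>d=1..v. vM d * (if d \<in> I then 1 else 0))" by (intro sum.cong) auto
    finally show ?thesis by (simp add: sum.distrib distrib_left)
  qed
  also have "\<dots> \<le> (\<Sum>d=1..v. vM d * (\<Sum>n | n \<in> I \<and> d dvd n. 1))"
  proof (intro sum_mono mult_left_mono mangoldt_nonneg)
    fix d assume d: "d \<in> {1..v}"
    have card: "(\<Sum>n | n \<in> I \<and> d dvd n. 1) = real (card {n \<in> I. d dvd n})" by simp
    show "(if d \<in> I then 1 else 0) + (if coprime d Q then real (N div d) else 0)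
        \<le> (\<Sum>n | n \<in> I \<and> d dvd n. 1 :: real)"
    proof (cases "d \<in> I")
      case True
      hence "N div d = 0" using large by simp
      moreover have "card {n \<in> I. d dvd n} > 0" using True fin by (auto simp: card_gt_0_iff)
      ultimately show ?thesis using True unfolding card by simp
    next
      case False
      thus ?thesis unfolding card
        using card_multiples_progression[of d Q N c k0] d Q by (auto simp: I_def)
    qed
  qed
  also have "\<dots> = (\<Sum>n\<in>I. ln (real n))" using sum_ln_eq_sum_mangoldt[OF I, of "\<lambda>_. 1"] by simp
  finally have main: "(\<Sum>d\<in>I. vM d) + (\<Sum>d=1..v. vM d * (if coprime d Q then real (N div d) else 0))
      \<le> (\<Sum>n\<in>I. ln (real n))" .
  have "sum_ln N = (\<Sum>d=1..v. vM d * real (N div d))"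
    unfolding sum_ln_mangoldt using Nv by (intro sum.mono_neutral_left) auto
  also have "\<dots> = (\<Sum>d=1..v. vM d * (if coprime d Q then real (N div d) else 0)
      + (if \<not> coprime d Q then vM d * real (N div d) else 0))"
    by (intro sum.cong) auto
  also have "\<dots> = (\<Sum>d=1..v. vM d * (if coprime d Q then real (N div d) else 0))
      + (\<Sum>d | d \<in> {1..v} \<and> \<not> coprime d Q. vM d * real (N div d))"
    unfolding sum.distrib by (intro arg_cong2[where f = "(+)"] refl sum.inter_filter[symmetric]) simp
  also have "(\<Sum>d | d \<in> {1..v} \<and> \<not> coprime d Q. vM d * real (N div d))
      \<le> (\<Sum>p\<in>prime_factors Q. \<Sum>d | d \<in> {1..v} \<and> p dvd d. vM d * real (N div d))"
    using Q by (intro sum_mangoldt_not_coprime_le) auto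
  also have "\<dots> \<le> (\<Sum>p\<in>prime_factors Q. N * (ln (real p) / (real p - 1)))"
  proof (rule sum_mono)
    fix p assume "p \<in> prime_factors Q"
    hence "prime p" by (simp add: in_prime_factors_iff)
    thus "(\<Sum>d | d \<in> {1..v} \<and> p dvd d. vM d * real (N div d)) \<le> N * (ln (real p) / (real p - 1))"
      using sum_mangoldt_multiples_div_le[of p N v] Nv by simp
  qed
  also have "\<dots> = N * sieve_const Q" by (simp add: sieve_const_def sum_distrib_left)
  finally show ?thesis using main by simp
qed

text \<open>\<open>k0\<close> is the least index whose term exceeds \<open>u\<close>. Adding
  \<open>Q\<close> before subtracting \<open>c\<close> prevents truncation, because
  \<open>c < Q\<close>. Rounding at the ends costs at most one extra term.\<close>

lemma progression_interval:
  fixes u v Q c :: nat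
  assumes c: "c < Q" and uv: "u \<le> v"
  defines "k0 \<equiv> (u + Q - c) div Q" and "N \<equiv> (v + Q - c) div Q - (u + Q - c) div Q"
  shows "{n \<in> {u<..v}. n mod Q = c} = (\<lambda>k. c + k * Q) ` {k0..<k0+N}"
    and "N * Q \<le> v - u + Q" and "c + k0 * Q \<le> u + Q" and "N > 0 \<Longrightarrow> c + (k0 + N - 1) * Q \<le> v"
proof -
  have Q: "Q > 0" using c by simp
  have le: "(u + Q - c) div Q \<le> (v + Q - c) div Q" using uv by (intro div_le_mono) auto
  have kN: "k0 + N = (v + Q - c) div Q" using le by (simp add: k0_def N_def)
  have less: "x < c + k * Q \<longleftrightarrow> (x + Q - c) div Q \<le> k" for x k
  proof -
    have "(x + Q - c) div Q \<le> k \<longleftrightarrow> (x + Q - c) div Q < k + 1" by auto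
    also have "\<dots> \<longleftrightarrow> x + Q - c < (k + 1) * Q" using Q by (rule div_less_iff_less_mult)
    also have "\<dots> \<longleftrightarrow> x < c + k * Q" using c by auto
    finally show ?thesis by blast
  qed
  show "{n \<in> {u<..v}. n mod Q = c} = (\<lambda>k. c + k * Q) ` {k0..<k0+N}"
  proof (rule subset_antisym; rule subsetI)
    fix n assume n: "n \<in> {n \<in> {u<..v}. n mod Q = c}"
    define k where "k = n div Q"
    have nk: "n = c + k * Q" using n by (auto simp: k_def)
    have "k0 \<le> k" using n less[of u k] unfolding nk k0_def by simp
    moreover have "k < k0 + N" using n less[of v k] unfolding nk kN by auto
    ultimately show "n \<in> (\<lambda>k. c + k * Q) ` {k0..<k0+N}" using nk by auto
  next
    fix n assume "n \<in> (\<lambda>k. c + k * Q) ` {k0..<k0+N}"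
    then obtain k where k: "n = c + k * Q" "k \<in> {k0..<k0+N}" by blast
    hence k: "n = c + k * Q" "k0 \<le> k" "k < k0 + N" by simp_all
    have "u < n" using k less[of u k] by (simp add: k0_def)
    moreover have "n \<le> v" using k less[of v k] unfolding kN by auto
    ultimately show "n \<in> {n \<in> {u<..v}. n mod Q = c}" using k c by simp
  qed
  have a: "k0 * Q \<le> u + Q - c" unfolding k0_def by simp
  thus "c + k0 * Q \<le> u + Q" using c by simp
  have "(k0 + N) * Q \<le> v + Q - c" unfolding kN by simp
  moreover have "u < c + k0 * Q" using less[of u k0] by (simp add: k0_def)
  ultimately show "N * Q \<le> v - u + Q" using c by (simp add: algebra_simps)
  assume "N > 0"
  hence "k0 + N - 1 < (v + Q - c) div Q" using kN by simp
  thus "c + (k0 + N - 1) * Q \<le> v" using less[of v "k0 + N - 1"] by simp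
qed

text \<open>Concavity: the right-hand side is the tangent of \<open>x - x * ln x\<close> at
  \<open>y\<close>.\<close>

lemma neg_x_ln_x_tangent:
  fixes x y :: real
  assumes "x \<ge> 0" "y > 0"
  shows "x - x * ln x \<le> y - x * ln y"
proof (cases "x = 0")
  case False
  hence x: "x > 0" using assms by simp
  have "ln (y / x) \<le> y / x - 1" using x assms by (intro ln_le_minus_one) auto
  thus ?thesis using x assms by (simp add: ln_div field_simps)
qed (use assms in simp)

text \<open>
  The right-hand side is the tangent at \<open>N0\<close> of the concave function \<open>N \<mapsto> N ln (\<mu> / N) + N\<close>,
  so that rounding of the number of terms costs only a logarithm.
\<close>
lemma sum_mangoldt_interval_le:
  fixes u v Q c :: nat and \<mu> N0 :: real
  assumes c: "c < Q" "coprime c Q" and uv: "u \<le> v" and u: "v - u + Q \<le> u * Q"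
    and N0: "N0 > 0" "real (v - u) / Q + 1 \<le> N0 + 2" and mu: "N0 \<le> \<mu>"
  shows "(\<Sum>d | d \<in> {u<..v} \<and> d mod Q = c. vM d) \<le>
    (\<Sum>n | n \<in> {u<..v} \<and> n mod Q = c. ln n - ln \<mu>)
     + N0 * (ln (\<mu> / N0) + sieve_const Q + 1) + 2 * (ln (\<mu> / N0) + sieve_const Q)"
proof -
  define k0 where "k0 = (u + Q - c) div Q"
  define N where "N = (v + Q - c) div Q - (u + Q - c) div Q"
  define I where "I = (\<lambda>k. c + k * Q) ` {k0..<k0+N}"
  have Q: "Q > 0" using c by simp
  have I: "{n. n \<in> {u<..v} \<and> n mod Q = c} = I"
    unfolding I_def k0_def N_def using progression_interval(1)[OF c(1) uv] .
  have NQ: "N * Q \<le> v - u + Q" unfolding N_def using progression_interval(2)[OF c(1) uv] .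
  hence "N * Q \<le> u * Q" using u by linarith
  \<comment> \<open>This makes every term of the progression larger than the number of terms, as the
    progression bound requires.\<close>
  hence Nu: "N \<le> u" using Q by simp
  have "real (N * Q) \<le> real (v - u + Q)" using NQ by (simp only: of_nat_le_iff)
  hence "real N \<le> real (v - u) / Q + 1" using Q by (simp add: field_simps)
  hence N2: "real N \<le> N0 + 2" using N0 by simp
  have inj: "inj_on (\<lambda>k. c + k * Q) {k0..<k0+N}" using Q by (auto simp: inj_on_def)
  have card: "card I = N" unfolding I_def by (subst card_image[OF inj]) simp
  have "(\<Sum>d\<in>I. vM d) \<le> (\<Sum>n\<in>I. ln (real n)) - sum_ln N + N * sieve_const Q"
    unfolding I_def
  proof (rule sum_mangoldt_progression_le[OF Q])
    have "u < c + k0 * Q \<or> N = 0"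
    proof (cases "N = 0")
      case False
      hence "c + k0 * Q \<in> I" by (auto simp: I_def)
      thus ?thesis unfolding I[symmetric] by simp
    qed simp
    show "c + k0 * Q > 0"
    proof (cases "c = 0")
      case True
      hence "k0 = (u + Q) div Q" by (simp add: k0_def)
      hence "k0 > 0" using Q by (simp add: div_greater_zero_iff)
      thus ?thesis using Q by simp
    qed simp
    fix n assume "n \<in> (\<lambda>k. c + k * Q) ` {k0..<k0+N}"
    hence n: "n \<in> I" by (simp add: I_def)
    thus "coprime n Q" using c(2) unfolding I[symmetric] 
      by (metis (mono_tags, lifting) coprime_mod_left_iff mem_Collect_eq Q less_numeral_extra(3))
    show "N < n" using n Nu unfolding I[symmetric] by simp
  qed
  also have "(\<Sum>n\<in>I. ln (real n)) = (\<Sum>n\<in>I. ln n - ln \<mu>) + N * ln \<mu>"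
    by (simp add: sum_subtractf card)
  also have "\<dots> - sum_ln N \<le> (\<Sum>n\<in>I. ln n - ln \<mu>) + N * ln \<mu> - (N * ln N - N)"
    using sum_ln_ge[of N] by simp
  also have "\<dots> \<le> (\<Sum>n\<in>I. ln n - ln \<mu>) + N * ln \<mu> + (N0 - N * ln N0)"
    using neg_x_ln_x_tangent[of N N0] N0 by simp
  also have "\<dots> = (\<Sum>n\<in>I. ln n - ln \<mu>) + N * ln (\<mu> / N0) + N0"
    using N0 mu by (simp add: ln_div algebra_simps)
  finally have "(\<Sum>d\<in>I. vM d) \<le> (\<Sum>n\<in>I. ln n - ln \<mu>) + N * (ln (\<mu> / N0) + sieve_const Q) + N0"
    by (simp add: algebra_simps)
  also have "N * (ln (\<mu> / N0) + sieve_const Q) \<le> (N0 + 2) * (ln (\<mu> / N0) + sieve_const Q)"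
  proof (rule mult_right_mono[OF N2])
    have "ln (\<mu> / N0) \<ge> 0" using N0 mu by simp
    moreover have "sieve_const Q \<ge> 0" unfolding sieve_const_def
    proof (intro sum_nonneg)
      fix p assume "p \<in> prime_factors Q"
      hence "p > 1" using prime_gt_1_nat by (auto simp only: in_prime_factors_iff)
      thus "0 \<le> ln (real p) / (real p - 1)" by simp
    qed
    ultimately show "0 \<le> ln (\<mu> / N0) + sieve_const Q" by simp
  qed
  finally show ?thesis unfolding I by (simp add: algebra_simps)
qed

section \<open>Lower bound for primes congruent to 5 modulo 6\<close>

lemma ln_2_bounds: "0.6931 \<le> ln (2::real)" "ln (2::real) \<le> 0.6932"
  using ln_approx_bounds[of 2 5] by (simp_all add: eval_nat_numeral)

text \<open>Rational approximations of base-2 logarithms become exact integer comparisons, such as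
  \<open>5 ^ 31 \<le> 2 ^ 72\<close>.\<close>

lemma ln_le_ratio:
  fixes x y :: real
  assumes "x > 0" "y > 0" "x ^ a \<le> y ^ b" 
  shows "a * ln x \<le> b * ln y"
proof -
  have "ln (x ^ a) \<le> ln (y ^ b)" using assms by (subst ln_le_cancel_iff) auto
  thus ?thesis using assms by (simp add: ln_realpow)
qed

lemma ln_3_bounds: "1.0985 \<le> ln (3::real)" "ln (3::real) \<le> 1.099"
  using ln_approx_bounds[of 3 8] by (simp_all add: eval_nat_numeral)

lemma ln_5_bound: "ln (5::real) \<le> 1.6101"
  using ln_le_ratio[of 5 2 31 72] ln_2_bounds by simp

lemma ln_7_bound: "ln (7::real) \<le> 1.9464"
  using ln_le_ratio[of 7 2 26 73] ln_2_bounds by simp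

lemma ln_11_bound: "ln (11::real) \<le> 2.4"
  using ln_le_ratio[of 11 2 13 45] ln_2_bounds by simp

section \<open>Chebyshev's upper bound for \<open>psi\<close>\<close>

definition psi :: "nat \<Rightarrow> real" where "psi x = (\<Sum>d=1..x. vM d)"

lemma div_eq_iff_interval:
  fixes m d y :: nat
  assumes "d > 0" "y > 0"
  shows "m div d = y \<longleftrightarrow> d \<in> {m div (y + 1)<..m div y}"
proof -
  have "m div d = y \<longleftrightarrow> y \<le> m div d \<and> m div d < y + 1" by auto
  also have "\<dots> \<longleftrightarrow> y * d \<le> m \<and> m < (y + 1) * d"
    using assms by (simp add: less_eq_div_iff_mult_less_eq div_less_iff_less_mult)
  also have "\<dots> \<longleftrightarrow> d \<le> m div y \<and> m div (y + 1) < d"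
    using assms by (simp add: less_eq_div_iff_mult_less_eq div_less_iff_less_mult mult.commute)
  finally show ?thesis by auto
qed

lemma ln_le_tangent:
  fixes x t :: real
  assumes "x > 0" "t > 0"
  shows "ln x \<le> x / t + ln t - 1"
proof -
  have "ln (x / t) \<le> x / t - 1" using assms by (intro ln_le_minus_one) auto
  thus ?thesis using assms by (simp add: ln_div)
qed

text \<open>Chebyshev's argument with the central binomial coefficient: the coefficient
  \<open>x div d - 2 * (x div d div 2)\<close> is 0 or 1, and it is 1 throughout
  \<open>(x / 2, x]\<close>.\<close>

lemma psi_half_le:
  assumes "x \<ge> 2"
  shows "psi x - psi (x div 2) \<le> x * ln 2 + 3 * ln x + 3"
proof -
  have "psi x - psi (x div 2) = (\<Sum>d\<in>{x div 2<..x}. vM d)"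
  proof -
    have "{1..x} = {1..x div 2} \<union> {x div 2<..x}" by auto
    hence "psi x = psi (x div 2) + (\<Sum>d\<in>{x div 2<..x}. vM d)"
      unfolding psi_def by (simp only:) (subst sum.union_disjoint, auto)
    thus ?thesis by simp
  qed
  also have "\<dots> = (\<Sum>d=1..x. if d \<in> {x div 2<..x} then vM d else 0)"
    by (subst sum.If_cases) (auto intro!: sum.cong)
  also have "\<dots> \<le> (\<Sum>d=1..x. vM d * (real (x div d) - 2 * real (x div d div 2)))"
  proof (intro sum_mono)
    fix d assume d: "d \<in> {1..x}"
    have "x div d - 2 * (x div d div 2) = x div d mod 2" by (simp add: minus_mult_div_eq_mod)
    hence eq: "real (x div d) - 2 * real (x div d div 2) = real (x div d mod 2)"
      by (metis of_nat_diff of_nat_mult of_nat_numeral times_div_less_eq_dividend)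
    show "(if d \<in> {x div 2<..x} then vM d else 0) \<le> vM d * (real (x div d) - 2 * real (x div d div 2))"
    proof (cases "d \<in> {x div 2<..x}")
      case True
      hence "x div d = 1" using div_eq_iff_interval[of d 1 x] d by (simp add: numeral_2_eq_2)
      thus ?thesis using True by simp
    next
      case False
      hence "(if d \<in> {x div 2<..x} then vM d else 0) = 0" by (simp only: if_False)
      also have "\<dots> \<le> vM d * real (x div d mod 2)" by (intro mult_nonneg_nonneg mangoldt_nonneg) simp
      finally show ?thesis unfolding eq .
    qed
  qed
  also have "\<dots> = sum_ln x - 2 * sum_ln (x div 2)"
    unfolding sum_ln_div[OF zero_less_numeral] sum_ln_mangoldt[of x]
    by (simp add: sum_subtractf sum_distrib_left algebra_simps)
  also have "\<dots> \<le> x * ln 2 + 3 * ln x + 3"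
    using sum_ln_div_approx[of 1 x] sum_ln_div_approx[of 2 x] assms
    by (simp add: abs_le_iff field_simps)
  finally show ?thesis .
qed

text \<open>A crude bound suffices, as it is applied only at \<open>m div 121\<close>. The base
  range gives \<open>10 * 12000 = 120000\<close>. In the recursion the slopes
  \<open>0.7 + 0.6932 + 3/600\<close> stay below 1.4 by 0.0018, which beyond 12000 pays for the
  additive 21.\<close>

lemma psi_le: "psi x \<le> 1.4 * x + 120000"
proof (induction x rule: less_induct)
  case (less x)
  show ?case
  proof (cases "x \<le> 12000")
    case True
    have "psi x \<le> (\<Sum>d=1..x. 10)" unfolding psi_def
    proof (intro sum_mono)
      fix d assume d: "d \<in> {1..x}"
      have "vM d \<le> ln d" using d by (intro mangoldt_le) auto
      also have "ln (real d) \<le> ln (2 ^ 14)" using d True by (subst ln_le_cancel_iff) auto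
      also have "\<dots> \<le> 10" using ln_realpow[of 2 14] ln_2_bounds by simp
      finally show "vM d \<le> 10" .
    qed
    thus ?thesis using True by simp
  next
    case False
    have "ln (600::real) \<le> ln (2 ^ 10)" by (subst ln_le_cancel_iff) auto
    also have "\<dots> \<le> 7" using ln_realpow[of 2 10] ln_2_bounds by simp
    finally have ln600: "ln (600::real) \<le> 7" .
    have "psi x \<le> psi (x div 2) + (x * ln 2 + 3 * ln x + 3)" using psi_half_le[of x] False by simp
    also have "psi (x div 2) \<le> 1.4 * real (x div 2) + 120000" using False by (intro less.IH) auto
    also have "real (x div 2) \<le> x / 2" using of_nat_div_le_of_nat[of x 2, where ?'a = real] by simp
    also have "real x * ln 2 \<le> real x * 0.6932" using ln_2_bounds by (intro mult_left_mono) auto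
    also have "ln (real x) \<le> x / 600 + 7 - 1" using ln_le_tangent[of x 600] ln600 False by simp
    finally show ?thesis using False by simp
  qed
qed

section \<open>Von Mangoldt sums over classes modulo 6\<close>

lemma prime_factors_6: "prime_factors (6::nat) = {2, 3}"
proof -
  have "prime_factors (2 * 3 :: nat) = prime_factors 2 \<union> prime_factors 3"
    by (rule prime_factors_product) auto
  thus ?thesis by (simp add: prime_factorization_prime insert_commute)
qed

lemma sieve_const_6: "sieve_const 6 = ln 2 + ln 3 / 2"
  by (simp add: sieve_const_def prime_factors_6)

lemma sieve_const_6_prime:
  fixes q :: nat
  assumes "prime q" "q \<ge> 5"
  shows "sieve_const (6 * q) = ln 2 + ln 3 / 2 + ln (real q) / (real q - 1)"
proof -
  have "prime_factors (6 * q) = prime_factors 6 \<union> prime_factors q"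
    using assms by (intro prime_factors_product) auto
  also have "\<dots> = {2, 3, q}" using assms by (auto simp: prime_factors_6 prime_factorization_prime)
  finally show ?thesis using assms by (simp add: sieve_const_def)
qed

text \<open>By \<open>div_eq_iff_interval\<close> the interval consists of the \<open>d\<close> with
  \<open>m div d = y\<close>, on which \<open>cheb_weight\<close> is constant within a class modulo
  3.\<close>

definition class_sum :: "nat \<Rightarrow> nat \<Rightarrow> nat \<Rightarrow> real" where
  "class_sum m y c = (\<Sum>d | d \<in> {m div (y + 1)<..m div y} \<and> d mod 6 = c. vM d)"

text \<open>The expected number of terms is \<open>N0\<close>, the length
  \<open>m / (y * (y + 1))\<close> divided by 6. With \<open>mu = m / y\<close> the ratio
  \<open>mu / N0 = 6 * (y + 1)\<close> is free of \<open>m\<close>, so the bound is linear in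
  \<open>m\<close>.\<close>

lemma class_sum_le:
  assumes y: "1 \<le> y" "3 * (y + 1) \<le> m" and c: "c = 1 \<or> c = 5"
    and k: "ln (6 * (real y + 1)) + ln 2 + ln 3 / 2 + 1 \<le> k"
  shows "class_sum m y c \<le> m * (k / (6 * (y * (y + 1)))) + 2 * k"
proof -
  define u where "u = m div (y + 1)"
  define v where "v = m div y"
  define N0 where "N0 = m / (6 * (real y * (real y + 1)))"
  define mu where "mu = real m / y"
  have m: "real m > 0" using y by simp
  have ypos: "real y > 0" using y by simp
  have u_gt: "real m / (real y + 1) < real u + 1"
  proof -
    have "m < (u + 1) * (y + 1)" unfolding u_def
      using div_less_iff_less_mult[of "y + 1" m "u + 1"] by (simp add: u_def)
    hence "real m < real ((u + 1) * (y + 1))" by (simp only: of_nat_less_iff)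
    thus ?thesis by (simp add: field_simps)
  qed
  have v_le: "real v \<le> mu" unfolding v_def mu_def by (rule of_nat_div_le_of_nat)
  have uv: "u \<le> v" unfolding u_def v_def by (rule div_le_mono2) (use y in auto)
  have u3: "u \<ge> 3" unfolding u_def using y(2) by (simp add: less_eq_div_iff_mult_less_eq)
  have N0pos: "N0 > 0" unfolding N0_def using m ypos by simp
  have diff: "mu - m / (real y + 1) = 6 * N0"
    unfolding mu_def N0_def using ypos by (simp add: divide_simps) (simp add: algebra_simps)
  have ratio: "mu / N0 = 6 * (real y + 1)"
    unfolding mu_def N0_def using ypos m by (simp add: field_simps)
  have "mu \<le> 2 * (m / (real y + 1))" unfolding mu_def using ypos y m by (simp add: field_simps)
  hence "real v < 2 * (real u + 1)" using v_le u_gt by simp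
  hence "real v < real (2 * (u + 1))" by simp
  hence "v < 2 * (u + 1)" by (simp only: of_nat_less_iff)
  hence vu: "v - u + 6 \<le> u * 6" using u3 by arith
  have "real (v - u) = real v - real u" using uv by simp
  hence N2: "real (v - u) / 6 + 1 \<le> N0 + 2" using v_le u_gt diff by simp
  have "ln (mu / N0) \<ge> 0" unfolding ratio using ypos by simp
  have N0mu: "N0 \<le> mu"
  proof -
    have "mu = N0 * (6 * (real y + 1))" using ratio N0pos by (simp add: field_simps)
    moreover have "N0 * 1 \<le> N0 * (6 * (real y + 1))" using N0pos ypos by (intro mult_left_mono) auto
    ultimately show ?thesis by simp
  qed
  have cop: "coprime c 6" 
  proof -
    have "gcd 5 (6::nat) = 1" by (simp add: gcd_non_0_nat)
    hence "coprime (5::nat) 6" by (rule iffD2[OF coprime_iff_gcd_eq_1])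
    thus ?thesis using c by (elim disjE) (simp_all only: coprime_1_left)
  qed
  have "class_sum m y c \<le>
    (\<Sum>n | n \<in> {u<..v} \<and> n mod 6 = c. ln n - ln mu)
     + N0 * (ln (mu / N0) + sieve_const 6 + 1) + 2 * (ln (mu / N0) + sieve_const 6)"
    unfolding class_sum_def u_def[symmetric] v_def[symmetric]
    using c cop uv vu N0pos N2 N0mu by (intro sum_mangoldt_interval_le) auto
  also have "(\<Sum>n | n \<in> {u<..v} \<and> n mod 6 = c. ln n - ln mu) \<le> 0"
  proof (intro sum_nonpos)
    fix n assume n: "n \<in> {n. n \<in> {u<..v} \<and> n mod 6 = c}"
    hence "real n \<le> mu" "real n > 0" using v_le by auto
    thus "ln (real n) - ln mu \<le> 0" by simp
  qed
  also have "N0 * (ln (mu / N0) + sieve_const 6 + 1) \<le> N0 * k"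
    unfolding ratio sieve_const_6 using k N0pos by (intro mult_left_mono) auto
  also have "2 * (ln (mu / N0) + sieve_const 6) \<le> 2 * k"
    unfolding ratio sieve_const_6 using k by simp
  finally show ?thesis unfolding N0_def by (simp add: field_simps)
qed

abbreviation class_set :: "nat \<Rightarrow> nat \<Rightarrow> nat \<Rightarrow> nat set" where
  "class_set m y c \<equiv> {d. d \<in> {m div (y + 1)<..m div y} \<and> d mod 6 = c}"

lemma le_twice_sum_of_five:
  fixes w a b c t n :: real
  assumes "0 \<le> a" "0 \<le> b" "0 \<le> c" "0 \<le> t" "0 \<le> n"
    and "w \<le> 0 \<or> w \<le> 2 \<and> (1 \<le> a \<or> 1 \<le> b \<or> 1 \<le> c \<or> 1 \<le> t \<or> 1 \<le> n)"
  shows "w \<le> 2 * (a + b + c + t + n)"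
  using assms by auto

text \<open>For \<open>d\<close> coprime to 6 the weight can be positive only if \<open>y\<close> is
  1 modulo 12 and \<open>d\<close> is 5 modulo 6, or \<open>y\<close> is 5 modulo 12 and
  \<open>d\<close> is 1 modulo 6. The lists contain these \<open>y\<close> below 121, with the
  wanted \<open>y = 1\<close> kept apart; all larger \<open>y\<close> go into the tail.\<close>

lemma cheb_weight_le_classes:
  assumes d: "d \<in> {1..m}"
  shows "cheb_weight d (m div d) \<le> 2 * (of_bool (d \<in> class_set m 1 5)
    + (\<Sum>y\<in>{13,25,37,49,61,73,85,97,109}. of_bool (d \<in> class_set m y 5))
    + (\<Sum>y\<in>{5,17,29,41,53,65,77,89,101,113}. of_bool (d \<in> class_set m y 1))
    + of_bool (d \<in> {1..m div 121}) + of_bool (d \<in> {d. d \<in> {1..m} \<and> \<not> coprime d 6}))"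
    (is "_ \<le> 2 * (?a + (\<Sum>y\<in>?Y5. _) + (\<Sum>y\<in>?Y1. _) + ?t + ?n)")
proof -
  define y where "y = m div d"
  have ypos: "y \<ge> 1" using d by (simp add: y_def Suc_le_eq div_greater_zero_iff)
  have in_class: "d \<in> class_set m z c \<longleftrightarrow> y = z \<and> d mod 6 = c" if "z > 0" for z c
    using div_eq_iff_interval[of d z m] d that by (auto simp: y_def)
  have tail: "d \<in> {1..m div 121} \<longleftrightarrow> 121 \<le> y"
    using d by (simp add: y_def less_eq_div_iff_mult_less_eq mult.commute)
  have nonneg: "?a \<ge> (0::real)" "(\<Sum>y\<in>?Y5. of_bool (d \<in> class_set m y 5)) \<ge> (0::real)"
    "(\<Sum>y\<in>?Y1. of_bool (d \<in> class_set m y 1)) \<ge> (0::real)" "?t \<ge> (0::real)" "?n \<ge> (0::real)"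
    by (auto intro!: sum_nonneg simp del: sum.insert)
  show ?thesis unfolding y_def[symmetric]
  proof (rule le_twice_sum_of_five[OF nonneg], cases "cheb_weight d y \<le> 0")
    case True
    thus "cheb_weight d y \<le> 0 \<or> cheb_weight d y \<le> 2 \<and> (1 \<le> ?a
      \<or> 1 \<le> (\<Sum>y\<in>?Y5. of_bool (d \<in> class_set m y 5) :: real)
      \<or> 1 \<le> (\<Sum>y\<in>?Y1. of_bool (d \<in> class_set m y 1) :: real) \<or> 1 \<le> ?t \<or> 1 \<le> ?n)" by blast
  next
    case False
    have le: "cheb_weight d y \<le> (if d mod 3 = 0 then 1
      else if d mod 3 = 2 \<and> y mod 12 = 1 \<or> d mod 3 = 1 \<and> y mod 12 = 5 then 2 else 0)"
      by (rule cheb_weight_le)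
    hence le2: "cheb_weight d y \<le> 2" by (auto split: if_splits)
    have "1 \<le> ?a \<or> 1 \<le> (\<Sum>y\<in>?Y5. of_bool (d \<in> class_set m y 5) :: real)
      \<or> 1 \<le> (\<Sum>y\<in>?Y1. of_bool (d \<in> class_set m y 1) :: real) \<or> 1 \<le> ?t \<or> 1 \<le> ?n"
      (is "?A \<or> ?B \<or> ?C \<or> ?T \<or> ?N")
    proof (cases "coprime d 6")
      case False
      hence "d \<in> {d. d \<in> {1..m} \<and> \<not> coprime d 6}" using d by blast
      hence ?N by (simp only: of_bool_eq order.refl)
      thus ?thesis by blast
    next
      case True
      have n3: "\<not> 3 dvd d" 
        using True coprime_common_divisor_nat[of d 6 3] by auto
      have n2: "\<not> 2 dvd d"
        using True coprime_common_divisor_nat[of d 6 2] by auto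
      have "d mod 3 \<noteq> 0" using n3 by (simp add: dvd_eq_mod_eq_0)
      with le False have cs: "d mod 3 = 2 \<and> y mod 12 = 1 \<or> d mod 3 = 1 \<and> y mod 12 = 5"
        by (auto split: if_splits)
      have mem: "1 \<le> (\<Sum>y\<in>Y. of_bool (d \<in> class_set m y c) :: real)" if "finite Y" "y \<in> Y" "d mod 6 = c" for Y c
      proof -
        have "of_bool (d \<in> class_set m y c) \<le> (\<Sum>y\<in>Y. of_bool (d \<in> class_set m y c) :: real)"
          using that by (intro member_le_sum) auto
        thus ?thesis using in_class[of y c] ypos that by simp
      qed
      show ?thesis
      proof (cases "121 \<le> y")
        case True
        hence ?T using tail by (simp only: of_bool_eq order.refl)
        thus ?thesis by blast
      next
        case False
        from cs show ?thesis
        proof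
          assume c: "d mod 3 = 2 \<and> y mod 12 = 1"
          hence d6: "d mod 6 = 5" using n2 by presburger
          have yk: "y = 12 * (y div 12) + 1" using c div_mult_mod_eq[of y 12] by simp
          hence "y div 12 < 10" using False by linarith
          hence "y div 12 \<in> {0,1,2,3,4,5,6,7,8,9}" by auto
          hence "y = 1 \<or> y \<in> ?Y5" using yk by auto
          thus ?thesis
          proof
            assume "y = 1"
            hence "d \<in> class_set m 1 5" using in_class[OF zero_less_one, of 5] d6 by blast
            hence ?A by (simp only: of_bool_eq order.refl)
            thus ?thesis by blast
          next
            assume "y \<in> ?Y5"
            hence ?B using d6 by (intro mem) auto
            thus ?thesis by blast
          qed
        next
          assume c: "d mod 3 = 1 \<and> y mod 12 = 5"
          hence d6: "d mod 6 = 1" using n2 by presburger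
          have yk: "y = 12 * (y div 12) + 5" using c div_mult_mod_eq[of y 12] by simp
          hence "y div 12 < 10" using False by linarith
          hence "y div 12 \<in> {0,1,2,3,4,5,6,7,8,9}" by auto
          hence "y \<in> ?Y1" using yk by auto
          hence ?C using d6 by (intro mem) auto
          thus ?thesis by blast
        qed
      qed
    qed
    thus "cheb_weight d y \<le> 0 \<or> cheb_weight d y \<le> 2 \<and> (?A \<or> ?B \<or> ?C \<or> ?T \<or> ?N)"
      using le2 by blast
  qed
qed

lemma sum_mangoldt_of_bool:
  assumes "B \<subseteq> {1..m}"
  shows "(\<Sum>d=1..m. vM d * of_bool (d \<in> B)) = (\<Sum>d\<in>B. vM d)"
proof -
  have "(\<Sum>d=1..m. vM d * of_bool (d \<in> B)) = (\<Sum>d\<in>{1..m} \<inter> B. vM d)"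
    by (simp add: of_bool_def sum.If_cases if_distrib cong: if_cong)
  also have "{1..m} \<inter> B = B" using assms by auto
  finally show ?thesis .
qed

lemma class_set_subset: "y > 0 \<Longrightarrow> class_set m y c \<subseteq> {1..m}"
  by (auto intro: order.trans[OF _ div_le_dividend])

lemma sum_cheb_weight_le:
  assumes m: "m > 0"
  shows "(\<Sum>d=1..m. vM d * cheb_weight d (m div d)) \<le> 2 * (class_sum m 1 5
    + (\<Sum>y\<in>{13,25,37,49,61,73,85,97,109}. class_sum m y 5)
    + (\<Sum>y\<in>{5,17,29,41,53,65,77,89,101,113}. class_sum m y 1)
    + psi (m div 121) + 2 * ln m)"
    (is "_ \<le> 2 * (_ + (\<Sum>y\<in>?Y5. _) + (\<Sum>y\<in>?Y1. _) + _ + _)")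
proof -
  let ?N = "{d. d \<in> {1..m} \<and> \<not> coprime d 6}"
  have cl: "(\<Sum>d=1..m. vM d * of_bool (d \<in> class_set m y c)) = class_sum m y c" if "y > 0" for y c
    unfolding class_sum_def by (rule sum_mangoldt_of_bool[OF class_set_subset[OF that]])
  have cls: "(\<Sum>d=1..m. \<Sum>y\<in>Y. vM d * of_bool (d \<in> class_set m y c)) = (\<Sum>y\<in>Y. class_sum m y c)"
    if "0 \<notin> Y" for Y c
  proof -
    have "(\<Sum>d=1..m. \<Sum>y\<in>Y. vM d * of_bool (d \<in> class_set m y c))
        = (\<Sum>y\<in>Y. \<Sum>d=1..m. vM d * of_bool (d \<in> class_set m y c))" by (rule sum.swap)
    also have "\<dots> = (\<Sum>y\<in>Y. class_sum m y c)"
    proof (rule sum.cong[OF refl])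
      fix y assume "y \<in> Y"
      hence "y > 0" using that by (cases y) auto
      thus "(\<Sum>d=1..m. vM d * of_bool (d \<in> class_set m y c)) = class_sum m y c" by (rule cl)
    qed
    finally show ?thesis .
  qed
  have "(\<Sum>d=1..m. vM d * cheb_weight d (m div d)) \<le> (\<Sum>d=1..m. vM d *
    (2 * (of_bool (d \<in> class_set m 1 5)
    + (\<Sum>y\<in>?Y5. of_bool (d \<in> class_set m y 5))
    + (\<Sum>y\<in>?Y1. of_bool (d \<in> class_set m y 1))
    + of_bool (d \<in> {1..m div 121}) + of_bool (d \<in> ?N))))"
    by (intro sum_mono mult_left_mono mangoldt_nonneg cheb_weight_le_classes)
  also have "\<dots> = 2 * ((\<Sum>d=1..m. vM d * of_bool (d \<in> class_set m 1 5))
    + (\<Sum>d=1..m. \<Sum>y\<in>?Y5. vM d * of_bool (d \<in> class_set m y 5))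
    + (\<Sum>d=1..m. \<Sum>y\<in>?Y1. vM d * of_bool (d \<in> class_set m y 1))
    + (\<Sum>d=1..m. vM d * of_bool (d \<in> {1..m div 121})) + (\<Sum>d=1..m. vM d * of_bool (d \<in> ?N)))"
    by (simp only: sum_distrib_left[symmetric] sum.distrib[symmetric] distrib_left[symmetric]
        mult.left_commute[of _ 2])
  also have "(\<Sum>d=1..m. vM d * of_bool (d \<in> class_set m 1 5)) = class_sum m 1 5" by (rule cl) simp
  also have "(\<Sum>d=1..m. \<Sum>y\<in>?Y5. vM d * of_bool (d \<in> class_set m y 5)) = (\<Sum>y\<in>?Y5. class_sum m y 5)"
    by (rule cls) simp
  also have "(\<Sum>d=1..m. \<Sum>y\<in>?Y1. vM d * of_bool (d \<in> class_set m y 1)) = (\<Sum>y\<in>?Y1. class_sum m y 1)"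
    by (rule cls) simp
  also have "(\<Sum>d=1..m. vM d * of_bool (d \<in> {1..m div 121})) = psi (m div 121)"
    unfolding psi_def by (rule sum_mangoldt_of_bool) (auto intro: order.trans[OF _ div_le_dividend])
  also have "(\<Sum>d=1..m. vM d * of_bool (d \<in> ?N)) = (\<Sum>d\<in>?N. vM d)"
    by (rule sum_mangoldt_of_bool) auto
  also have "(\<Sum>d\<in>?N. vM d) \<le> 2 * ln m"
  proof -
    have "(\<Sum>d\<in>?N. vM d) = (\<Sum>d\<in>?N. vM d * 1)" by simp
    also have "\<dots> \<le> (\<Sum>p\<in>prime_factors 6. \<Sum>d | d \<in> {1..m} \<and> p dvd d. vM d * 1)"
      by (rule sum_mangoldt_not_coprime_le) auto
    also have "\<dots> = (\<Sum>d | d \<in> {1..m} \<and> 2 dvd d. vM d) + (\<Sum>d | d \<in> {1..m} \<and> 3 dvd d. vM d)"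
      by (simp add: prime_factors_6)
    also have "\<dots> \<le> ln m + ln m"
      using m by (intro add_mono sum_mangoldt_multiples_le) auto
    finally show ?thesis by simp
  qed
  finally show ?thesis by simp
qed

lemma ln_bound_2_3:
  fixes x :: real
  assumes "x > 0" "x \<le> 2 ^ a * 3 ^ b"
  shows "ln x \<le> a * ln 2 + b * ln 3"
proof -
  have "ln x \<le> ln (2 ^ a * 3 ^ b)" using assms by (subst ln_le_cancel_iff) auto
  thus ?thesis by (simp add: ln_mult ln_realpow)
qed

lemma class_sum_1_5_ge:
  assumes m: "m \<ge> 2 ^ 30"
  shows "class_sum m 1 5 \<ge> 0.19 * m"
proof -
  have mr: "real m \<ge> 2 ^ 30" using m by (metis of_nat_le_iff of_nat_numeral of_nat_power)
  note L = ln_2_bounds ln_3_bounds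
  \<comment> \<open>Here \<open>2.2427 = 0.6932 + 1.099 / 2 + 1\<close> covers all terms but
    \<open>ln (6 * (y + 1))\<close>, which is majorised through a number
    \<open>2 ^ a * 3 ^ b\<close>.\<close>
  have k: "ln (6 * (real y + 1)) + ln 2 + ln 3 / 2 + 1 \<le> k"
    if "6 * (real y + 1) \<le> 2 ^ a * 3 ^ b" "real a * 0.6932 + real b * 1.099 + 2.2427 \<le> k" for y a b k
  proof -
    have "ln (6 * (real y + 1)) \<le> a * ln 2 + b * ln 3" using that by (intro ln_bound_2_3) auto
    also have "\<dots> \<le> a * 0.6932 + b * 1.099" using L by (intro add_mono mult_left_mono) auto
    finally show ?thesis using that L by simp
  qed
  have cs: "class_sum m y c \<le> m * (k / (6 * (y * (y + 1)))) + 2 * k"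
    if "c = 1 \<or> c = 5" "1 \<le> y" "y \<le> 113" "6 * (real y + 1) \<le> 2 ^ a * 3 ^ b"
      "real a * 0.6932 + real b * 1.099 + 2.2427 \<le> k" for y c a b k
    using that m by (intro class_sum_le k[of y a b]) auto
  \<comment> \<open>The majorants of \<open>6 * (y + 1)\<close> are 36 for \<open>y = 5\<close>, 108
    up to 17, 324 up to 53 and 729 up to 113; the first three are attained.\<close>
  have cs5: "class_sum m 5 1 \<le> m * (5.83 / 180) + 11.66"
    using cs[of 1 5 2 2 "5.83"] by simp
  have csA: "class_sum m y c \<le> m * (6.93 / (6 * (y * (y + 1)))) + 13.86"
    if "c = 1 \<or> c = 5" "1 \<le> y" "y \<le> 17" for y c
    using cs[of c y 2 3 "6.93"] that by simp
  have csB: "class_sum m y c \<le> m * (8.03 / (6 * (y * (y + 1)))) + 16.06"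
    if "c = 1 \<or> c = 5" "1 \<le> y" "y \<le> 53" for y c
    using cs[of c y 2 4 "8.03"] that by simp
  have csC: "class_sum m y c \<le> m * (8.84 / (6 * (y * (y + 1)))) + 17.68"
    if "c = 1 \<or> c = 5" "1 \<le> y" "y \<le> 113" for y c
    using cs[of c y 0 6 "8.84"] that by simp
  have Y5: "(\<Sum>y\<in>{13,25,37,49,61,73,85,97,109}. class_sum m y 5)
     \<le> m * 0.01105 + 200"
    using csA[of 5 13] csB[of 5 25] csB[of 5 37] csB[of 5 49] csC[of 5 61] csC[of 5 73] csC[of 5 85]
      csC[of 5 97] csC[of 5 109] by simp
  have Y1: "(\<Sum>y\<in>{5,17,29,41,53,65,77,89,101,113}. class_sum m y 1)
     \<le> m * 0.03998 + 200"
    using cs5 csA[of 1 17] csB[of 1 29] csB[of 1 41] csB[of 1 53] csC[of 1 65] csC[of 1 77] csC[of 1 89]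
      csC[of 1 101] csC[of 1 113] by simp
  have "real (m div 121) \<le> m / 121" using of_nat_div_le_of_nat[of m 121, where ?'a = real] by simp
  hence tail: "psi (m div 121) \<le> 1.4 * (m / 121) + 120000" using psi_le[of "m div 121"] by simp
  have lnm: "ln (real m) \<le> m / 2 ^ 30 + 20"
  proof -
    have "ln (real m) \<le> m / 2 ^ 30 + ln (2 ^ 30) - 1" using mr by (intro ln_le_tangent) auto
    thus ?thesis using ln_realpow[of 2 30] L by simp
  qed
  have "m * (0.6931 / 3 + 1.0985 / 4) \<le> m * (ln 2 / 3 + ln 3 / 4)"
    using L by (intro mult_left_mono) auto
  also have "\<dots> \<le> (\<Sum>d=1..m. vM d * cheb_weight d (m div d)) + 8 * ln m + 6"
    using sum_cheb_weight_ge[of m] m by simp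
  finally have low: "m * (0.6931 / 3 + 1.0985 / 4)
    \<le> (\<Sum>d=1..m. vM d * cheb_weight d (m div d)) + 8 * ln m + 6" .
  have up: "(\<Sum>d=1..m. vM d * cheb_weight d (m div d)) \<le> 2 * (class_sum m 1 5
    + (\<Sum>y\<in>{13,25,37,49,61,73,85,97,109}. class_sum m y 5)
    + (\<Sum>y\<in>{5,17,29,41,53,65,77,89,101,113}. class_sum m y 1)
    + psi (m div 121) + 2 * ln m)"
    using m by (intro sum_cheb_weight_le) auto
  \<comment> \<open>Half of \<open>0.6931 / 3 + 1.0985 / 4\<close>, less
    \<open>0.01105 + 0.03998 + 1.4 / 121\<close>, is about 0.19022. From \<open>2 ^ 30\<close> on,
    the surplus over 0.19 exceeds 120000 plus the remaining constants and logarithms.\<close>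
  have "0.19 * M \<le> g" if "M * (0.6931 / 3 + 1.0985 / 4) \<le> S + 8 * l + 6" "S \<le> 2 * (g + a + b + p + 2 * l)"
    "a \<le> M * 0.01105 + 200" "b \<le> M * 0.03998 + 200" "p \<le> 1.4 * (M / 121) + 120000" "l \<le> M / 2 ^ 30 + 20"
    "M \<ge> 2 ^ 30" for M S l g a b p :: real using that by simp
  from this[OF low up Y5 Y1 tail lnm mr] show ?thesis .
qed

section \<open>Existence of a good prime\<close>

text \<open>By the Chinese remainder theorem both conditions on a bad prime form a single class, to
  which the progression bound applies.\<close>

lemma residue_class_5_mod_6_1_mod_q:
  fixes q :: nat
  assumes q: "prime q" "q \<ge> 5"
  obtains c where "c < 6 * q" "coprime c (6 * q)"
    "\<And>d. d mod (6 * q) = c \<longleftrightarrow> d mod 6 = 5 \<and> d mod q = 1"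
proof -
  have "\<not> q dvd 2" "\<not> q dvd 3" using q by (auto dest: dvd_imp_le)
  hence "coprime q 2" "coprime q 3" using q(1) prime_imp_coprime by blast+
  hence "coprime q (2 * 3)" unfolding coprime_mult_right_iff by blast
  hence cop: "coprime 6 q" by (simp add: coprime_commute)
  obtain x where x: "[x = 5] (mod 6)" "[x = 1] (mod q)"
    using binary_chinese_remainder_nat[OF cop] by blast
  define c where "c = x mod (6 * q)"
  have c_iff: "d mod (6 * q) = c \<longleftrightarrow> d mod 6 = 5 \<and> d mod q = 1" for d
  proof -
    have "d mod (6 * q) = c \<longleftrightarrow> [d = x] (mod (6 * q))" by (simp add: c_def cong_def)
    also have "\<dots> \<longleftrightarrow> [d = x] (mod 6) \<and> [d = x] (mod q)"
      using cop by (metis coprime_cong_mult_nat cong_modulus_mult_nat mult.commute)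
    also have "[d = x] (mod 6) \<longleftrightarrow> [d = 5] (mod 6)" using x(1) cong_trans cong_sym by blast
    also have "[d = x] (mod q) \<longleftrightarrow> [d = 1] (mod q)" using x(2) cong_trans cong_sym by blast
    finally show ?thesis using q by (simp add: cong_def)
  qed
  have lt: "c < 6 * q" using q by (simp add: c_def)
  hence c56: "c mod 6 = 5" "c mod q = 1" using c_iff[of c] by auto
  have "coprime c q" using c56(2) q
    by (metis coprime_1_left coprime_mod_left_iff not_prime_0 q(1))
  moreover have "\<not> 2 dvd c" "\<not> 3 dvd c" using c56(1) by presburger+
  hence "coprime c 2" "coprime c 3"
    using prime_imp_coprime[of 2 c] prime_imp_coprime[of 3 c] coprime_commute by auto
  hence "coprime c (2 * 3)" unfolding coprime_mult_right_iff by blast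
  hence "coprime c 6" by simp
  ultimately have "coprime c (6 * q)" by simp
  thus ?thesis using that lt c_iff by blast
qed

lemma sum_progression:
  "2 * (\<Sum>k=k0..<k0+N. real (c + k * Q)) = real N * (2 * real c + real Q * (2 * real k0 + real N - 1))"
  by (induction N) (auto simp: algebra_simps)

text \<open>Comparing the terms with their mean \<open>3 m / 4\<close> instead of \<open>m\<close> is what makes the case
  of the prime factors 5 and 7 work.\<close>
lemma sum_ln_progression_le:
  fixes m c Q :: nat
  assumes c: "c < Q" and Q: "Q \<le> 6 * m" and m: "m > 0"
  shows "(\<Sum>n | n \<in> {m div 2<..m} \<and> n mod Q = c. ln n - ln (3 * real m / 4)) \<le> 5"
proof -
  define u where "u = m div 2"
  define k0 where "k0 = (u + Q - c) div Q"
  define N where "N = (m + Q - c) div Q - (u + Q - c) div Q"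
  define mu where "mu = 3 * real m / 4"
  have um: "u \<le> m" by (simp add: u_def)
  note pi = progression_interval[OF c um, folded k0_def N_def]
  have mu: "mu > 0" using m by (simp add: mu_def)
  have Qpos: "Q > 0" using c by simp
  have inj: "inj_on (\<lambda>k. c + k * Q) {k0..<k0+N}" using Qpos by (auto simp: inj_on_def)
  have "(\<Sum>n | n \<in> {u<..m} \<and> n mod Q = c. ln n - ln mu)
      \<le> (\<Sum>n | n \<in> {u<..m} \<and> n mod Q = c. (real n - mu) / mu)"
  proof (rule sum_mono)
    fix n assume "n \<in> {n. n \<in> {u<..m} \<and> n mod Q = c}"
    hence n: "real n > 0" by auto
    have "ln (real n / mu) \<le> real n / mu - 1" using n mu by (intro ln_le_minus_one) auto
    thus "ln (real n) - ln mu \<le> (real n - mu) / mu" using n mu by (simp add: ln_div field_simps)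
  qed
  also have "\<dots> = (\<Sum>n | n \<in> {u<..m} \<and> n mod Q = c. real n - mu) / mu"
    by (simp add: sum_divide_distrib)
  also have "(\<Sum>n | n \<in> {u<..m} \<and> n mod Q = c. real n - mu) = (\<Sum>k=k0..<k0+N. real (c + k * Q)) - N * mu"
  proof -
    have "(\<Sum>n | n \<in> {u<..m} \<and> n mod Q = c. real n - mu) = (\<Sum>k=k0..<k0+N. real (c + k * Q) - mu)"
      unfolding pi(1) by (subst sum.reindex[OF inj]) simp
    thus ?thesis by (simp add: sum_subtractf)
  qed
  \<comment> \<open>The first term is at most \<open>u + Q\<close> and the last at most
    \<open>m\<close>, so their mean, which is the mean of the progression, exceeds \<open>mu\<close>
    by at most \<open>Q / 2\<close>.\<close>
  also have "\<dots> \<le> real N * Q / 2"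
  proof (cases "N = 0")
    case False
    have k0N: "real (k0 + N - 1) = real k0 + real N - 1" using False by (simp add: of_nat_diff)
    have "real (c + k0 * Q) \<le> real (u + Q)" using pi(3) by (simp only: of_nat_le_iff)
    hence "real c + real k0 * real Q \<le> real u + real Q" by simp
    moreover have "real (c + (k0 + N - 1) * Q) \<le> real m" using pi(4) False by (simp only: of_nat_le_iff)
    hence "real c + (real k0 + real N - 1) * real Q \<le> real m"
      by (simp only: of_nat_add[of c] of_nat_mult k0N)
    moreover have "real u \<le> real m / 2" unfolding u_def
      using of_nat_div_le_of_nat[of m 2, where ?'a = real] by simp
    ultimately have "2 * real c + real Q * (2 * real k0 + real N - 1) \<le> 2 * mu + Q"
      by (simp add: mu_def algebra_simps)
    hence "real N * (2 * real c + real Q * (2 * real k0 + real N - 1)) \<le> real N * (2 * mu + Q)"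
      by (intro mult_left_mono) auto
    thus ?thesis using sum_progression[of c Q k0 N] by (simp add: algebra_simps)
  qed simp
  \<comment> \<open>\<open>N * Q \<le> 7 * m\<close>, and \<open>7/2 * m\<close> is below
    \<open>5 * mu = 15/4 * m\<close>.\<close>
  also have "real N * Q / 2 \<le> 5 * mu"
  proof -
    have "real (N * Q) \<le> real (m - u + Q)" using pi(2) by (simp only: of_nat_le_iff)
    also have "\<dots> \<le> 7 * real m" using Q um by simp
    finally show ?thesis by (simp add: mu_def)
  qed
  finally show ?thesis using mu unfolding u_def mu_def by (simp add: field_simps)
qed

text \<open>The coefficient of \<open>m\<close> in the progression bound for modulus
  \<open>6 * q\<close> on \<open>(m / 2, m]\<close>: the expected number of terms is
  \<open>N0 = m / (12 * q)\<close>, its ratio to the mean \<open>3 * m / 4\<close> gives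
  \<open>9 * q\<close>, and the last three summands are \<open>sieve_const (6 * q)\<close>.\<close>

definition bad_weight :: "nat \<Rightarrow> real" where
  "bad_weight q = (ln (9 * q) + 1 + ln 2 + ln 3 / 2 + ln q / (real q - 1)) / (12 * q)"

lemma bad_weight_le:
  fixes q :: nat
  assumes "prime q" "q \<ge> 5"
  shows "bad_weight q \<le> (if q = 5 then 0.1076 else if q = 7 then 0.08 else 0.054)"
proof -
  note L = ln_2_bounds ln_3_bounds
  have ln9: "ln (9 * real q) = 2 * ln 3 + ln q" if "q > 0" for q
    using that ln_realpow[of 3 2] by (simp add: ln_mult)
  consider "q = 5" | "q = 7" | "q \<ge> 11"
  proof -
    have "q \<noteq> 6" "q \<noteq> 8" "q \<noteq> 9" "q \<noteq> 10" using assms(1) by auto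
    thus ?thesis using that assms(2) by linarith
  qed
  thus ?thesis
  proof cases
    case 1
    thus ?thesis unfolding bad_weight_def using ln9[of 5] L ln_5_bound by simp
  next
    case 2
    thus ?thesis unfolding bad_weight_def using ln9[of 7] L ln_7_bound by simp
  next
    case 3
    \<comment> \<open>Tangent at 11, the worst case of this branch:
      \<open>11 / 11 + 6.1 = 7.1\<close> is just below
      \<open>0.054 * 12 * 11 = 7.128\<close>.\<close>
    have lnq: "ln (real q) \<le> q / 11 + 1.4"
      using ln_le_tangent[of q 11] ln_11_bound 3 by simp
    hence "ln (real q) \<le> 0.25 * (real q - 1)" using 3 by simp
    define x where "x = ln (real q) / (real q - 1)"
    from \<open>ln (real q) \<le> 0.25 * (real q - 1)\<close> have r: "x \<le> 0.25"
      unfolding x_def using 3 by (simp add: divide_le_eq)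
    have "ln (9 * real q) + 1 + ln 2 + ln 3 / 2 + ln q / (real q - 1) \<le> real q / 11 + 6.1"
      unfolding x_def[symmetric] using ln9[of q] lnq r L 3 by simp
    also have "\<dots> \<le> 0.054 * (12 * real q)" using 3 by simp
    finally have "bad_weight q \<le> 0.054" unfolding bad_weight_def x_def[symmetric] using 3 by (simp add: divide_le_eq)
    thus ?thesis using 3 by simp
  qed
qed

text \<open>The additive error is 5 from comparing the terms with their mean, and
  \<open>2 * (ln m + 5)\<close> from rounding the number of terms.\<close>

lemma sum_mangoldt_bad_le:
  fixes q m :: nat
  assumes q: "prime q" "q \<ge> 5" "q \<le> m" and m: "m \<ge> 100"
  shows "(\<Sum>d | d \<in> {m div 2<..m} \<and> d mod 6 = 5 \<and> d mod q = 1. vM d)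
    \<le> m * bad_weight q + 2 * ln m + 15"
proof -
  obtain c where c: "c < 6 * q" "coprime c (6 * q)"
    "\<And>d. d mod (6 * q) = c \<longleftrightarrow> d mod 6 = 5 \<and> d mod q = 1"
    using residue_class_5_mod_6_1_mod_q[OF q(1,2)] by blast
  define u where "u = m div 2"
  define N0 where "N0 = m / (12 * real q)"
  define mu where "mu = 3 * real m / 4"
  have qpos: "real q > 0" and mpos: "real m > 0" using q m by auto
  have u_m: "u \<le> m" "m - u \<le> u + 1" "u \<ge> 50" unfolding u_def using m by auto
  have ratio: "mu / N0 = 9 * q" unfolding mu_def N0_def using qpos mpos by (simp add: field_simps)
  have N0pos: "N0 > 0" unfolding N0_def using qpos mpos by simp
  have "ln (real q) \<le> real q - 1" using qpos by (intro ln_le_minus_one) auto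
  hence lnq: "ln (real q) / (real q - 1) \<le> 1" using q by (simp add: divide_le_eq)
  have vu: "m - u + 6 * q \<le> u * (6 * q)"
  proof -
    have "1 * (u - 1) \<le> (6 * q - 1) * (u - 1)" using q by (intro mult_right_mono) auto
    hence "u - 1 + (u - 1) \<le> 6 * q * (u - 1)" using q u_m by (simp add: diff_mult_distrib)
    moreover have "u + 1 \<le> u - 1 + (u - 1)" using u_m by simp
    moreover have "u * (6 * q) = 6 * q * (u - 1) + 6 * q" using u_m by (simp add: algebra_simps diff_mult_distrib2)
    ultimately show ?thesis using u_m by linarith
  qed
  have "real (m - u) \<le> real m / 2 + 1"
  proof -
    have "2 * (m - u) \<le> m + 1" unfolding u_def by auto
    hence "real (2 * (m - u)) \<le> real (m + 1)" by (simp only: of_nat_le_iff)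
    thus ?thesis by simp
  qed
  hence "real (m - u) / real (6 * q) \<le> (real m / 2 + 1) / real (6 * q)" by (intro divide_right_mono) auto
  also have "\<dots> = N0 + 1 / real (6 * q)" unfolding N0_def using qpos by (simp add: field_simps)
  also have "\<dots> \<le> N0 + 1" using q by simp
  finally have N2: "real (m - u) / real (6 * q) + 1 \<le> N0 + 2" by simp
  have N0mu: "N0 \<le> mu"
  proof -
    have "mu = N0 * (9 * real q)" using ratio N0pos by (simp add: field_simps)
    moreover have "N0 * 1 \<le> N0 * (9 * real q)" using N0pos q by (intro mult_left_mono) auto
    ultimately show ?thesis by simp
  qed
  have "(\<Sum>d | d \<in> {u<..m} \<and> d mod (6 * q) = c. vM d) \<le>
    (\<Sum>n | n \<in> {u<..m} \<and> n mod (6 * q) = c. ln n - ln mu)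
     + N0 * (ln (mu / N0) + sieve_const (6 * q) + 1) + 2 * (ln (mu / N0) + sieve_const (6 * q))"
    using c u_m(1) vu N0pos N2 N0mu by (intro sum_mangoldt_interval_le) auto
  also have "(\<Sum>n | n \<in> {u<..m} \<and> n mod (6 * q) = c. ln n - ln mu) \<le> 5"
    unfolding u_def mu_def using c q m by (intro sum_ln_progression_le) auto
  also have "N0 * (ln (mu / N0) + sieve_const (6 * q) + 1) = m * bad_weight q"
  proof -
    have "ln (mu / N0) + sieve_const (6 * q) + 1
        = ln (9 * q) + 1 + ln 2 + ln 3 / 2 + ln q / (real q - 1)"
      unfolding ratio sieve_const_6_prime[OF q(1,2)] by simp
    thus ?thesis unfolding bad_weight_def N0_def by simp
  qed
  also have "ln (mu / N0) + sieve_const (6 * q) \<le> ln m + 5"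
  proof -
    have "ln (9 * real q) = 2 * ln 3 + ln q" using qpos ln_realpow[of 3 2] by (simp add: ln_mult)
    moreover have "ln (real q) \<le> ln m" using q by simp
    ultimately show ?thesis
      unfolding ratio sieve_const_6_prime[OF q(1,2)] using ln_2_bounds ln_3_bounds lnq by simp
  qed
  finally show ?thesis unfolding c(3) u_def by simp
qed

text \<open>A proper prime power up to \<open>m\<close> belongs to a prime at most
  \<open>sqrt m\<close>, and all powers of one prime together weigh at most
  \<open>ln m\<close>.\<close>

lemma sum_mangoldt_not_prime_le:
  fixes m :: nat
  assumes m: "m > 0" and A: "A \<subseteq> {1..m}" "\<And>d. d \<in> A \<Longrightarrow> \<not> prime d"
  shows "(\<Sum>d\<in>A. vM d) \<le> sqrt m * ln m"
proof -
  define P where "P = {p. prime p \<and> p\<^sup>2 \<le> m}"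
  have P: "P \<subseteq> {1..nat \<lfloor>sqrt m\<rfloor>}"
  proof
    fix p assume p: "p \<in> P"
    hence "real (p\<^sup>2) \<le> real m" unfolding P_def by (simp only: of_nat_le_iff mem_Collect_eq)
    hence "real p \<le> sqrt m" by (intro real_le_rsqrt) simp
    moreover have "p \<ge> 1" using p prime_ge_1_nat by (auto simp: P_def)
    ultimately show "p \<in> {1..nat \<lfloor>sqrt m\<rfloor>}" by (simp add: le_nat_iff le_floor_iff)
  qed
  hence finP: "finite P" using finite_subset by blast
  have cardP: "real (card P) \<le> sqrt m"
  proof -
    have "card P \<le> nat \<lfloor>sqrt m\<rfloor>" using card_mono[OF _ P] by simp
    hence "real (card P) \<le> real (nat \<lfloor>sqrt m\<rfloor>)" by (simp only: of_nat_le_iff)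
    also have "\<dots> \<le> sqrt m" by simp
    finally show ?thesis .
  qed
  have "(\<Sum>d\<in>A. vM d) = (\<Sum>d\<in>{d\<in>A. primepow d}. vM d)"
    using A finite_subset[OF A(1)] by (intro sum.mono_neutral_right) (auto simp: mangoldt_def)
  also have "\<dots> \<le> (\<Sum>d\<in>(\<Union>p\<in>P. {d. d \<in> {1..m} \<and> p dvd d}). vM d)"
  proof (rule sum_mono2)
    show "{d \<in> A. primepow d} \<subseteq> (\<Union>p\<in>P. {d. d \<in> {1..m} \<and> p dvd d})"
    proof
      fix d assume d: "d \<in> {d \<in> A. primepow d}"
      then obtain p k where pk: "prime p" "k > 0" "d = p ^ k" unfolding primepow_def by auto
      have "k \<noteq> 1" using pk A(2)[of d] d by auto
      hence "p\<^sup>2 dvd d" unfolding pk(3) using pk(2) by (intro le_imp_power_dvd) auto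
      moreover have "d \<in> {1..m}" using d A(1) by blast
      ultimately have "p \<in> P" using pk(1) by (auto simp: P_def dest!: dvd_imp_le)
      thus "d \<in> (\<Union>p\<in>P. {d. d \<in> {1..m} \<and> p dvd d})"
        using pk \<open>d \<in> {1..m}\<close> by (auto intro!: dvd_power)
    qed
  qed (use finP in \<open>auto intro: mangoldt_nonneg\<close>)
  also have "\<dots> \<le> (\<Sum>p\<in>P. \<Sum>d | d \<in> {1..m} \<and> p dvd d. vM d)"
    using finP by (intro sum_UN_le) (auto intro: mangoldt_nonneg)
  also have "\<dots> \<le> (\<Sum>p\<in>P. ln m)"
    using m by (intro sum_mono sum_mangoldt_multiples_le) (auto simp: P_def)
  also have "\<dots> \<le> sqrt m * ln m" using cardP m by (simp add: mult_right_mono)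
  finally show ?thesis .
qed

lemma sum_bad_weight_le:
  assumes "finite S" "card S \<le> 2" "\<And>q. q \<in> S \<Longrightarrow> prime q \<and> q \<ge> 5"
  shows "(\<Sum>q\<in>S. bad_weight q) \<le> 0.1876"
proof -
  let ?b = "\<lambda>q::nat. if q = 5 then 0.1076 else if q = 7 then 0.08 else (0.054::real)"
  have "(\<Sum>q\<in>S. bad_weight q) \<le> (\<Sum>q\<in>S. ?b q)" using assms bad_weight_le by (intro sum_mono) auto
  also have "\<dots> \<le> 0.1876"
  proof -
    have "card S = 0 \<or> card S = 1 \<or> card S = 2" using assms by linarith
    thus ?thesis
    proof (elim disjE)
      assume "card S = 1"
      then obtain a where S: "S = {a}" by (auto simp: card_1_singleton_iff)
      show ?thesis unfolding S by simp
    next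
      assume "card S = 2"
      then obtain a b where S: "S = {a, b}" "a \<noteq> b" by (auto simp: card_2_iff)
      show ?thesis unfolding S(1) using S(2) by simp
    qed (use assms in simp)
  qed
  finally show ?thesis .
qed

text \<open>If no prime is good, the class 5 modulo 6 in \<open>(m / 2, m]\<close> is covered by
  non-primes, by prime divisors of \<open>l\<close>, and by the classes 1 modulo \<open>q\<close>
  for primes \<open>q\<close> dividing \<open>l\<close>; their total weight is too small.\<close>

lemma good_prime_exists:
  fixes l m :: nat
  assumes l: "l > 0" "odd l" "card (prime_factors l) \<le> 2" and m: "m \<ge> 2 ^ 30"
  shows "\<exists>p. prime p \<and> m div 2 < p \<and> p \<le> m \<and> \<not> p dvd l \<and> coprime l (p - 1)"
proof (rule ccontr)
  assume none: "\<not> ?thesis"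
  define P where "P = prime_factors l"
  \<comment> \<open>The prime 2 is excluded as \<open>l\<close> is odd, and 3 because
    \<open>d - 1\<close> is 1 modulo 3. The bound \<open>q \<le> m\<close> comes from
    \<open>q dvd d - 1\<close> and keeps \<open>ln q\<close> in the error term below
    \<open>ln m\<close>.\<close>
  define P' where "P' = {q \<in> P. 5 \<le> q \<and> q \<le> m}"
  define B where "B q = {d. d \<in> {m div 2<..m} \<and> d mod 6 = 5 \<and> d mod q = 1}" for q
  let ?C = "{d. d \<in> {m div 2<..m} \<and> d mod 6 = 5}"
  let ?D = "{d \<in> ?C. \<not> prime d}"
  have m1: "m > 1" "m \<ge> 100" using m by auto
  have lnm0: "ln (real m) \<ge> 0" using m1 by simp
  have finP: "finite P" "card P \<le> 2" using l by (auto simp: P_def)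
  have cover: "?C \<subseteq> ?D \<union> ((P \<inter> {1..m}) \<union> (\<Union>q\<in>P'. B q))"
  proof
    fix d assume d: "d \<in> ?C"
    show "d \<in> ?D \<union> ((P \<inter> {1..m}) \<union> (\<Union>q\<in>P'. B q))"
    proof (cases "prime d")
      case True
      have d1: "d > 1" using True prime_gt_1_nat by blast
      show ?thesis
      proof (cases "d dvd l")
        case True
        thus ?thesis using \<open>prime d\<close> d d1 l(1) by (auto simp: P_def in_prime_factors_iff)
      next
        case False
        hence "\<not> coprime l (d - 1)" using none True d by auto
        hence "gcd l (d - 1) \<noteq> 1" using coprime_iff_gcd_eq_1 by blast
        then obtain q where q: "prime q" "q dvd gcd l (d - 1)" using prime_factor_nat by blast
        have ql: "q dvd l" and qd: "q dvd d - 1" using q(2) by (meson dvd_trans gcd_dvd1 gcd_dvd2)+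
        have "q \<noteq> 2" using ql l(2) by auto
        moreover have "q \<noteq> 3"
        proof
          assume "q = 3"
          hence "3 dvd d - 1" "d mod 6 = 5" using qd d by auto
          thus False using d1 by presburger
        qed
        moreover have "q \<noteq> 4" using q(1) by auto
        ultimately have q5: "q \<ge> 5" using q(1) prime_ge_2_nat[of q] by linarith
        have "q \<le> d - 1" using qd d1 by (intro dvd_imp_le) auto
        hence qm: "q \<le> m" using d by auto
        have "d mod q = 1"
        proof -
          obtain j where "d - 1 = q * j" using qd by auto
          hence "d = q * j + 1" using d1 by simp
          hence "d mod q = 1 mod q" by (simp only: mod_mult_self4)
          thus ?thesis using q5 by simp
        qed
        hence "d \<in> B q" using d by (simp add: B_def)
        moreover have "q \<in> P'" using ql q(1) l(1) q5 qm by (auto simp: P'_def P_def in_prime_factors_iff)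
        ultimately show ?thesis by blast
      qed
    qed (use d in auto)
  qed
  have finB: "finite (B q)" for q by (simp add: B_def)
  have finP': "finite P'" using finP by (simp add: P'_def)
  have "0.19 * m \<le> (\<Sum>d\<in>?C. vM d)"
    using class_sum_1_5_ge[OF m] by (simp add: class_sum_def numeral_2_eq_2)
  also have "\<dots> \<le> (\<Sum>d\<in>?D \<union> ((P \<inter> {1..m}) \<union> (\<Union>q\<in>P'. B q)). vM d)"
    using cover finB finP' by (intro sum_mono2) (auto intro: mangoldt_nonneg)
  also have "\<dots> \<le> (\<Sum>d\<in>?D. vM d) + (\<Sum>d\<in>(P \<inter> {1..m}) \<union> (\<Union>q\<in>P'. B q). vM d)"
    using finB finP' by (subst sum_Un) (auto intro!: sum_nonneg mangoldt_nonneg)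
  also have "(\<Sum>d\<in>(P \<inter> {1..m}) \<union> (\<Union>q\<in>P'. B q). vM d)
      \<le> (\<Sum>d\<in>P \<inter> {1..m}. vM d) + (\<Sum>d\<in>(\<Union>q\<in>P'. B q). vM d)"
    using finB finP' by (subst sum_Un) (auto intro!: sum_nonneg mangoldt_nonneg)
  also have "(\<Sum>d\<in>(\<Union>q\<in>P'. B q). vM d) \<le> (\<Sum>q\<in>P'. \<Sum>d\<in>B q. vM d)"
    using finB finP' by (intro sum_UN_le) (auto intro: mangoldt_nonneg)
  finally have main: "0.19 * m \<le> (\<Sum>d\<in>?D. vM d) + ((\<Sum>d\<in>P \<inter> {1..m}. vM d) + (\<Sum>q\<in>P'. \<Sum>d\<in>B q. vM d))"
    by simp
  have D: "(\<Sum>d\<in>?D. vM d) \<le> sqrt m * ln m"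
    using m1 by (intro sum_mangoldt_not_prime_le) auto
  have PP: "(\<Sum>d\<in>P \<inter> {1..m}. vM d) \<le> 2 * ln m"
  proof -
    have "(\<Sum>d\<in>P \<inter> {1..m}. vM d) \<le> (\<Sum>d\<in>P \<inter> {1..m}. ln m)"
    proof (rule sum_mono)
      fix d assume "d \<in> P \<inter> {1..m}"
      hence d: "d > 0" "d \<le> m" by auto
      have "vM d \<le> ln d" using d by (intro mangoldt_le)
      also have "\<dots> \<le> ln m" using d by simp
      finally show "vM d \<le> ln m" .
    qed
    also have "\<dots> = real (card (P \<inter> {1..m})) * ln m" by simp
    also have "\<dots> \<le> 2 * ln m"
    proof (rule mult_right_mono)
      have "card (P \<inter> {1..m}) \<le> card P" using finP by (intro card_mono) auto
      thus "real (card (P \<inter> {1..m})) \<le> 2" using finP by simp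
    qed (rule lnm0)
    finally show ?thesis .
  qed
  have cardP': "card P' \<le> 2"
  proof -
    have "card P' \<le> card P" using finP by (intro card_mono) (auto simp: P'_def)
    thus ?thesis using finP by simp
  qed
  have P'_prime: "prime q" "q \<ge> 5" "q \<le> m" if "q \<in> P'" for q
    using that by (auto simp: P'_def P_def in_prime_factors_iff)
  have BB: "(\<Sum>q\<in>P'. \<Sum>d\<in>B q. vM d) \<le> 0.1876 * m + (4 * ln m + 30)"
  proof -
    have "(\<Sum>q\<in>P'. \<Sum>d\<in>B q. vM d) \<le> (\<Sum>q\<in>P'. m * bad_weight q + (2 * ln m + 15))"
    proof (rule sum_mono)
      fix q assume q: "q \<in> P'"
      show "(\<Sum>d\<in>B q. vM d) \<le> m * bad_weight q + (2 * ln m + 15)"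
        using sum_mangoldt_bad_le[OF P'_prime[OF q] m1(2)] unfolding B_def by simp
    qed
    also have "\<dots> = m * (\<Sum>q\<in>P'. bad_weight q) + real (card P') * (2 * ln m + 15)"
      by (simp add: sum.distrib sum_distrib_left)
    also have "\<dots> \<le> m * 0.1876 + 2 * (2 * ln m + 15)"
      using sum_bad_weight_le[OF finP' cardP'] P'_prime cardP' lnm0
      by (intro add_mono mult_left_mono mult_right_mono) auto
    finally show ?thesis by simp
  qed
  \<comment> \<open>With \<open>s \<ge> 2 ^ 15\<close>, the tangent of the logarithm at
    \<open>2 ^ 15\<close> makes \<open>ln m\<close> linear in \<open>s\<close>. Then
    \<open>s * ln m\<close> is handled through \<open>s * s = m\<close> and
    \<open>s \<le> m / 2 ^ 15\<close>.\<close>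
  define s where "s = sqrt m"
  have mr: "real m \<ge> 2 ^ 30" using m by (metis of_nat_le_iff of_nat_numeral of_nat_power)
  have s2: "s * s = m" by (simp add: s_def)
  have "sqrt ((2 ^ 15)\<^sup>2) \<le> s" unfolding s_def using mr by (intro real_sqrt_le_mono) simp
  hence s15: "s \<ge> 2 ^ 15" by simp
  have "ln (real m) = 2 * ln s" using s15 by (simp add: ln_mult flip: s2)
  also have "ln s \<le> s / 2 ^ 15 + ln (2 ^ 15) - 1" using s15 by (intro ln_le_tangent) auto
  also have "ln (2 ^ 15 :: real) \<le> 10.4" using ln_realpow[of 2 15] ln_2_bounds by simp
  finally have lnm: "ln (real m) \<le> 2 * s / 2 ^ 15 + 18.8" by simp
  have s_m: "s * 2 ^ 15 \<le> m" using s15 s2 by (metis mult_left_mono order_trans zero_le_numeral zero_le_power)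
  have "s * ln m \<le> s * (2 * s / 2 ^ 15 + 18.8)" using lnm s15 by (intro mult_left_mono) auto
  also have "\<dots> = 2 * (s * s) / 2 ^ 15 + 18.8 * s" by (simp add: algebra_simps)
  finally have "s * ln m \<le> 2 * real m / 2 ^ 15 + 18.8 * s" unfolding s2 .
  hence DD: "(\<Sum>d\<in>?D. vM d) \<le> 2 * real m / 2 ^ 15 + 18.8 * s" using D unfolding s_def by linarith
  \<comment> \<open>The gap \<open>0.19 - 0.1876 = 0.0024\<close> exceeds
    \<open>2 / 2 ^ 15 + 18.8 / 2 ^ 15\<close>, which is below 0.0007; the other terms are negligible
    from \<open>2 ^ 30\<close> on.\<close>
  have False if "0.19 * M \<le> d + (e + b)" "d \<le> 2 * M / 2 ^ 15 + 18.8 * t" "e \<le> 2 * L"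
    "b \<le> 0.1876 * M + (4 * L + 30)" "L \<le> 2 * t / 2 ^ 15 + 18.8" "t * 2 ^ 15 \<le> M" "M \<ge> 2 ^ 30"
    for M d e b t L :: real using that by simp
  from this[OF main DD PP BB lnm s_m mr] show False .
qed

section \<open>The main theorem\<close>

theorem theorem1:
  fixes l n :: nat
  assumes "l > 0" and "odd l" and "card (prime_factors l) \<le> 2" and "n > 0"
  shows "\<not> powerful (Omega l n)"
proof (cases "n + 1 < 2 ^ 30")
  case True
  thus ?thesis
    using not_powerful_Omega_small[OF assms(1-4)] not_powerful_Omega_below[OF assms(1-3), of n]
    by (cases "n \<le> 21") auto
next
  case False
  hence "2 ^ 30 \<le> n + 1" by simp
  then obtain p where p: "prime p" "(n + 1) div 2 < p" "p \<le> n + 1" "\<not> p dvd l" "coprime l (p - 1)"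
    using good_prime_exists[OF assms(1-3)] by blast
  moreover have "n + 1 < 2 * p" using p(2) by linarith
  ultimately show ?thesis using not_powerful_Omega_prime assms(2,4) by blast
qed

end
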